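(* Let $(M^{r,3-r},\phi,\xi,\eta,g)$, $r\in\{0,1\}$, be a three-dimensional pseudo-Riemannian Sasakian space-form with $\phi$-sectional curvature $H$. Let $\psi$ be a Sasakian quasi-Killing spinor (SqK-spinor) of type $(a,b)=\left(\frac{(-1)^r}{2},\frac{H-(-1)^r}{4}\right)$ which satisfies $\xi\cdot\psi=\pm(-\mathrm{i})^{r-1}\psi$ (for one fixed choice of sign) and has charge $1$, and let $\mathrm{i}B\eta$ be a $U(1)$-gauge field, where $B\in\mathbb{R}$. If $4B=\pm(-1)^{r-1}\langle\psi,\psi\rangle$ holds (with the same sign $\pm$), then the pair $(\psi,\mathrm{i}B\eta)$ is a solution to the Dirac-Maxwell (DM) system. Furthermore, in this situation, the triple $(\psi,\mathrm{i}B\eta,g)$ is a solution to the Einstein-Dirac-Maxwell (EDM) system with cosmological constant $\Lambda$ for $$H=\frac{-(-1)^r\langle\psi,\psi\rangle^2+(-1)^r\langle\psi,\psi\rangle-8}{\langle\psi,\psi\rangle-(-1)^r8},\qquad \Lambda=\frac{\langle\psi,\psi\rangle^2}{8}-\frac{\langle\psi,\psi\rangle}{4}+(-1)^r.$$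
   Context: Write $\mathrm{i}=\sqrt{-1}$; $r=0$ is the Riemannian case and $r=1$ the Lorentzian case. A Sasakian manifold is a contact metric manifold $(M,\phi,\xi,\eta,g)$ with Reeb field $\xi$, $\eta(\xi)=1$, satisfying $R(X,Y)\xi=\eta(Y)X-\eta(X)Y$; Lorentzian-Sasakian manifolds are obtained from Riemannian ones by replacing the metric $g'$ by $g'-2\eta\otimes\eta$, so $g(\xi,\xi)=(-1)^r$. The $\phi$-sectional curvature is $K(X,\phi X)$, $X\perp\xi$; a Sasakian space-form is a simply connected Sasakian manifold with constant $\phi$-sectional curvature $H$. In dimension three $\mathrm{Ric}=(H+(-1)^r)g+(1-(-1)^rH)\eta\otimes\eta$. In dimension three there is a global orthonormal frame (Sasakian frame) $e_1=\xi,e_2,e_3$, $g(e_i,e_j)=h_{ij}$, $h=\mathrm{diag}((-1)^r,1,1)$, with $[e_1,e_2]=-\frac{H+(-1)^r3}{2}e_3$, $[e_1,e_3]=\frac{H+(-1)^r3}{2}e_2$, $[e_2,e_3]=-2e_1$; the dual coframe is $\omega^1=\eta,\omega^2,\omega^3$, and $d\eta=2\omega^2\wedge\omega^3$. Indices are raised with $h$. Spinors: with respect to a Sasakian frame spinor fields are $\mathbb{C}^2$-valued functions, and $e_j$ acts by Clifford multiplication via $\gamma_1=(-\mathrm{i})^{r-1}\sigma_1$, $\gamma_2=\mathrm{i}\sigma_2$, $\gamma_3=\mathrm{i}\sigma_3$ ($\sigma_j$ the Pauli matrices). The spin connection is $\nabla_X\psi=X(\psi)+\omega^S(X)\psi$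 with $\omega^S=\frac{(-\mathrm{i})^r}{2}\sum_j\omega^j\gamma_j+\mathrm{i}^r\frac{H+(-1)^{r-1}}{4}\omega^1\gamma_1$. The Spin-invariant form is $\langle\psi_1,\psi_2\rangle=\psi_1^\dagger(\gamma_1)^r\psi_2$. An SqK-spinor of type $(a,b)$, $a,b\in\mathbb{R}$, is a spinor field with $\nabla_X\psi=a\,\mathrm{i}^rX\cdot\psi+b\,\mathrm{i}^r\eta(X)\xi\cdot\psi$ for all $X$; then $\langle\psi,\psi\rangle$ is constant. For a gauge field $\mathrm{i}A$ ($A$ a real one-form) and charge $q$ put $\nabla^c=\nabla+q\,\mathrm{i}A$, $D^c=\mathrm{i}^r\sum_j\gamma^j\nabla^c_{e_j}$, $F=dA$, $J_\psi=(-\mathrm{i})^{r-1}\sum_j\langle\psi,\gamma^j\psi\rangle e_j$. In dimension 3 the field equations are: (Dirac) $D^c\psi=\lambda\psi$ for some real constant $\lambda$; (Maxwell) $*d*F=q\;{}^\flat J_\psi$, with the Hodge star convention $*d*F=(-1)^{r-1}\sum_{j,k}\nabla^jF_{jk}\,\omega^k$ for $F=\frac12\sum F_{jk}\omega^j\wedge\omega^k$; (Einstein) $\mathrm{Ric}=T-\mathrm{tr}(T)g+2\Lambda g$ with $T=T^{em}+T^{spin}$, $T^{em}(X,Y)=g^*(\iota_XF,\iota_YF)-\frac14\|F\|^2g(X,Y)$, $\|F\|^2=\sum F_{jk}F^{jk}$ ($g^*$ the induced metric on one-forms), and $T^{spin}(X,Y)=\frac14\mathrm{Re}\langle\psi,\mathrm{i}^r(X\cdot\nabla^c_Y\psi+Y\cdot\nabla^c_X\psi)\rangle$.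 The DM system consists of (Dirac) and (Maxwell); the EDM system with cosmological constant $\Lambda$ consists of all three. *)

theory Defs
  imports "HOL-Analysis.Analysis"
begin

text \<open>The manifold is a whole type \<open>'m\<close>; Hausdorff and second countable are imposed through type
  classes in the definition of a smooth manifold below.\<close>

primrec Ck_on :: "nat \<Rightarrow> 'a::euclidean_space set \<Rightarrow> ('a \<Rightarrow> 'b::real_normed_vector) \<Rightarrow> bool" where
  "Ck_on 0 S f \<longleftrightarrow> continuous_on S f"
| "Ck_on (Suc k) S f \<longleftrightarrow> (\<forall>x\<in>S. f differentiable (at x)) \<and>
     (\<forall>b\<in>Basis. Ck_on k S (\<lambda>x. frechet_derivative f (at x) b))"

definition smooth_on :: "'a::euclidean_space set \<Rightarrow> ('a \<Rightarrow> 'b::real_normed_vector) \<Rightarrow> bool" where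
  "smooth_on S f \<longleftrightarrow> (\<forall>k. Ck_on k S f)"

type_synonym 'm atlas = "('m set \<times> ('m \<Rightarrow> real^3)) set"

definition smooth_manifold3 :: "('m::{t2_space,second_countable_topology}) atlas \<Rightarrow> bool" where
  "smooth_manifold3 C \<longleftrightarrow>
     (\<Union>(U, x)\<in>C. U) = UNIV \<and>
     (\<forall>(U, x)\<in>C. open U \<and> open (x ` U) \<and> homeomorphism U (x ` U) x (inv_into U x)) \<and>
     (\<forall>(U, x)\<in>C. \<forall>(V, y)\<in>C. smooth_on (x ` (U \<inter> V)) (y \<circ> inv_into U x))"

definition smooth_functions :: "'m atlas \<Rightarrow> ('m \<Rightarrow> real) set" where
  "smooth_functions C = {f. \<forall>(U, x)\<in>C. smooth_on (x ` U) (f \<circ> inv_into U x)}"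

text \<open>Tangent vectors at \<open>p\<close> are derivations at \<open>p\<close> of the algebra of smooth functions. Their value
  outside that algebra is fixed to 0, so that equality of tangent vectors is equality in HOL.
  Tensors are families of (multi)linear maps on the tangent spaces; their values on arguments that
  are not tangent vectors are irrelevant.\<close>

type_synonym 'm tvec = "('m \<Rightarrow> real) \<Rightarrow> real"
type_synonym 'm vfield = "'m \<Rightarrow> 'm tvec"
type_synonym 'm form1 = "'m \<Rightarrow> 'm tvec \<Rightarrow> real"
type_synonym 'm metric = "'m \<Rightarrow> 'm tvec \<Rightarrow> 'm tvec \<Rightarrow> real"
type_synonym 'm endo = "'m \<Rightarrow> 'm tvec \<Rightarrow> 'm tvec"
type_synonym 'm connection = "'m vfield \<Rightarrow> 'm vfield \<Rightarrow> 'm vfield"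

definition tangent_space :: "'m atlas \<Rightarrow> 'm \<Rightarrow> 'm tvec set" where
  "tangent_space C p = {v.
     (\<forall>f. f \<notin> smooth_functions C \<longrightarrow> v f = 0) \<and>
     (\<forall>f\<in>smooth_functions C. \<forall>g\<in>smooth_functions C. v (\<lambda>q. f q + g q) = v f + v g) \<and>
     (\<forall>c. \<forall>f\<in>smooth_functions C. v (\<lambda>q. c * f q) = c * v f) \<and>
     (\<forall>f\<in>smooth_functions C. \<forall>g\<in>smooth_functions C.
        v (\<lambda>q. f q * g q) = v f * g p + f p * v g)}"

definition vector_fields :: "'m atlas \<Rightarrow> 'm vfield set" where
  "vector_fields C = {X. (\<forall>p. X p \<in> tangent_space C p) \<and>
     (\<forall>f\<in>smooth_functions C. (\<lambda>p. X p f) \<in> smooth_functions C)}"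

definition deriv_along :: "'m vfield \<Rightarrow> ('m \<Rightarrow> real) \<Rightarrow> 'm \<Rightarrow> real" where
  "deriv_along X f = (\<lambda>p. X p f)"

definition lie_bracket :: "'m vfield \<Rightarrow> 'm vfield \<Rightarrow> 'm vfield" where
  "lie_bracket X Y = (\<lambda>p f. X p (deriv_along Y f) - Y p (deriv_along X f))"

definition one_form :: "'m atlas \<Rightarrow> 'm form1 \<Rightarrow> bool" where
  "one_form C \<alpha> \<longleftrightarrow>
     (\<forall>p. \<forall>v\<in>tangent_space C p. \<forall>w\<in>tangent_space C p. \<forall>a b.
        \<alpha> p (\<lambda>f. a * v f + b * w f) = a * \<alpha> p v + b * \<alpha> p w) \<and>
     (\<forall>X\<in>vector_fields C. (\<lambda>p. \<alpha> p (X p)) \<in> smooth_functions C)"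

definition ext_deriv :: "'m form1 \<Rightarrow> 'm vfield \<Rightarrow> 'm vfield \<Rightarrow> 'm \<Rightarrow> real" where
  "ext_deriv \<alpha> X Y p =
     X p (\<lambda>q. \<alpha> q (Y q)) - Y p (\<lambda>q. \<alpha> q (X q)) - \<alpha> p (lie_bracket X Y p)"

definition riemannian_metric :: "'m atlas \<Rightarrow> 'm metric \<Rightarrow> bool" where
  "riemannian_metric C g \<longleftrightarrow>
     (\<forall>p. \<forall>u\<in>tangent_space C p. \<forall>v\<in>tangent_space C p. \<forall>w\<in>tangent_space C p. \<forall>a b.
        g p (\<lambda>f. a * u f + b * v f) w = a * g p u w + b * g p v w) \<and>
     (\<forall>p. \<forall>v\<in>tangent_space C p. \<forall>w\<in>tangent_space C p. g p v w = g p w v) \<and>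
     (\<forall>p. \<forall>v\<in>tangent_space C p. v \<noteq> (\<lambda>f. 0) \<longrightarrow> g p v v > 0) \<and>
     (\<forall>X\<in>vector_fields C. \<forall>Y\<in>vector_fields C. (\<lambda>p. g p (X p) (Y p)) \<in> smooth_functions C)"

text \<open>\<open>nab X Y\<close> is the covariant derivative of \<open>Y\<close> along \<open>X\<close>.\<close>

definition levi_civita :: "'m atlas \<Rightarrow> 'm metric \<Rightarrow> 'm connection \<Rightarrow> bool" where
  "levi_civita C g nab \<longleftrightarrow>
     (\<forall>X\<in>vector_fields C. \<forall>Y\<in>vector_fields C. nab X Y \<in> vector_fields C) \<and>
     (\<forall>X\<in>vector_fields C. \<forall>Y\<in>vector_fields C. \<forall>Z\<in>vector_fields C.
        \<forall>u\<in>smooth_functions C. \<forall>v\<in>smooth_functions C.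
        nab (\<lambda>p f. u p * X p f + v p * Y p f) Z = (\<lambda>p f. u p * nab X Z p f + v p * nab Y Z p f)) \<and>
     (\<forall>X\<in>vector_fields C. \<forall>Y\<in>vector_fields C. \<forall>Z\<in>vector_fields C.
        nab X (\<lambda>p f. Y p f + Z p f) = (\<lambda>p f. nab X Y p f + nab X Z p f)) \<and>
     (\<forall>X\<in>vector_fields C. \<forall>Y\<in>vector_fields C. \<forall>u\<in>smooth_functions C.
        nab X (\<lambda>p f. u p * Y p f) = (\<lambda>p f. X p u * Y p f + u p * nab X Y p f)) \<and>
     (\<forall>X\<in>vector_fields C. \<forall>Y\<in>vector_fields C.
        (\<lambda>p f. nab X Y p f - nab Y X p f) = lie_bracket X Y) \<and>
     (\<forall>X\<in>vector_fields C. \<forall>Y\<in>vector_fields C. \<forall>Z\<in>vector_fields C. \<forall>p.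
        X p (\<lambda>q. g q (Y q) (Z q)) = g p (nab X Y p) (Z p) + g p (Y p) (nab X Z p))"

definition curvature :: "'m connection \<Rightarrow> 'm vfield \<Rightarrow> 'm vfield \<Rightarrow> 'm vfield \<Rightarrow> 'm vfield" where
  "curvature nab X Y Z =
     (\<lambda>p f. nab X (nab Y Z) p f - nab Y (nab X Z) p f - nab (lie_bracket X Y) Z p f)"

definition sectional_curvature ::
  "'m metric \<Rightarrow> 'm connection \<Rightarrow> 'm vfield \<Rightarrow> 'm vfield \<Rightarrow> 'm \<Rightarrow> real" where
  "sectional_curvature g nab X Y p =
     g p (curvature nab X Y Y p) (X p) /
     (g p (X p) (X p) * g p (Y p) (Y p) - (g p (X p) (Y p))\<^sup>2)"

text \<open>With the exterior derivative as normalised above (without factor 1/2), the compatibility of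
  a contact metric structure reads \<open>d\<eta>(X, Y) = 2 g(X, \<phi> Y)\<close>; this is the normalisation in which
  \<open>d\<eta> = 2 \<omega>\<^sup>2 \<and> \<omega>\<^sup>3\<close> and \<open>R(X, Y) \<xi> = \<eta>(Y) X - \<eta>(X) Y\<close>.\<close>

definition contact_metric ::
  "'m atlas \<Rightarrow> 'm endo \<Rightarrow> 'm vfield \<Rightarrow> 'm form1 \<Rightarrow> 'm metric \<Rightarrow> bool" where
  "contact_metric C \<phi> \<xi> \<eta> g \<longleftrightarrow>
     riemannian_metric C g \<and>
     one_form C \<eta> \<and>
     (\<forall>p. \<exists>X\<in>vector_fields C. \<exists>Y\<in>vector_fields C. \<exists>Z\<in>vector_fields C.
        \<eta> p (X p) * ext_deriv \<eta> Y Z p + \<eta> p (Y p) * ext_deriv \<eta> Z X p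
          + \<eta> p (Z p) * ext_deriv \<eta> X Y p \<noteq> 0) \<and>
     \<xi> \<in> vector_fields C \<and>
     (\<forall>p. \<eta> p (\<xi> p) = 1) \<and>
     (\<forall>X\<in>vector_fields C. \<forall>p. ext_deriv \<eta> \<xi> X p = 0) \<and>
     (\<forall>p. \<forall>v\<in>tangent_space C p. \<phi> p v \<in> tangent_space C p) \<and>
     (\<forall>p. \<forall>v\<in>tangent_space C p. \<forall>w\<in>tangent_space C p. \<forall>a b.
        \<phi> p (\<lambda>f. a * v f + b * w f) = (\<lambda>f. a * \<phi> p v f + b * \<phi> p w f)) \<and>
     (\<forall>X\<in>vector_fields C. (\<lambda>p. \<phi> p (X p)) \<in> vector_fields C) \<and>
     (\<forall>p. \<forall>v\<in>tangent_space C p. \<phi> p (\<phi> p v) = (\<lambda>f. - v f + \<eta> p v * \<xi> p f)) \<and>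
     (\<forall>p. \<forall>v\<in>tangent_space C p. \<eta> p v = g p v (\<xi> p)) \<and>
     (\<forall>X\<in>vector_fields C. \<forall>Y\<in>vector_fields C. \<forall>p.
        ext_deriv \<eta> X Y p = 2 * g p (X p) (\<phi> p (Y p)))"

definition sasakian ::
  "'m atlas \<Rightarrow> 'm endo \<Rightarrow> 'm vfield \<Rightarrow> 'm form1 \<Rightarrow> 'm metric \<Rightarrow> bool" where
  "sasakian C \<phi> \<xi> \<eta> g \<longleftrightarrow>
     contact_metric C \<phi> \<xi> \<eta> g \<and>
     (\<exists>nab. levi_civita C g nab \<and>
        (\<forall>X\<in>vector_fields C. \<forall>Y\<in>vector_fields C.
           curvature nab X Y \<xi> = (\<lambda>p f. \<eta> p (Y p) * X p f - \<eta> p (X p) * Y p f)))"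

definition pseudo_sasakian ::
  "'m atlas \<Rightarrow> nat \<Rightarrow> 'm endo \<Rightarrow> 'm vfield \<Rightarrow> 'm form1 \<Rightarrow> 'm metric \<Rightarrow> bool" where
  "pseudo_sasakian C r \<phi> \<xi> \<eta> g \<longleftrightarrow>
     r = 0 \<and> sasakian C \<phi> \<xi> \<eta> g \<or>
     r = 1 \<and> (\<exists>g'. sasakian C \<phi> \<xi> \<eta> g' \<and>
       (\<forall>p. \<forall>v\<in>tangent_space C p. \<forall>w\<in>tangent_space C p.
          g p v w = g' p v w - 2 * \<eta> p v * \<eta> p w))"

definition pseudo_sasakian_space_form3 ::
  "('m::{t2_space,second_countable_topology}) atlas \<Rightarrow> nat \<Rightarrow> 'm endo \<Rightarrow> 'm vfield \<Rightarrow> 'm form1 \<Rightarrow>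
   'm metric \<Rightarrow> 'm connection \<Rightarrow> real \<Rightarrow> bool" where
  "pseudo_sasakian_space_form3 C r \<phi> \<xi> \<eta> g nab H \<longleftrightarrow>
     smooth_manifold3 C \<and> simply_connected (UNIV :: 'm set) \<and>
     pseudo_sasakian C r \<phi> \<xi> \<eta> g \<and> levi_civita C g nab \<and>
     (\<forall>X\<in>vector_fields C. \<forall>p. X p \<noteq> (\<lambda>f. 0) \<and> g p (X p) (\<xi> p) = 0 \<longrightarrow>
        sectional_curvature g nab X (\<lambda>q. \<phi> q (X q)) p = H)"

text \<open>Frame indices live in the type \<open>3\<close>, whose elements are 1, 2, 3 (with 3 = 0).\<close>

definition hsign :: "nat \<Rightarrow> 3 \<Rightarrow> real" where
  "hsign r j = (if j = 1 then (-1) ^ r else 1)"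

definition global_frame :: "'m atlas \<Rightarrow> (3 \<Rightarrow> 'm vfield) \<Rightarrow> bool" where
  "global_frame C e \<longleftrightarrow> (\<forall>j. e j \<in> vector_fields C) \<and>
     (\<forall>p. \<forall>v\<in>tangent_space C p. \<exists>!c :: real^3. v = (\<lambda>f. \<Sum>k\<in>UNIV. c $ k * e k p f))"

definition coframe :: "(3 \<Rightarrow> 'm vfield) \<Rightarrow> 3 \<Rightarrow> 'm form1" where
  "coframe e j p v = (THE c :: real^3. v = (\<lambda>f. \<Sum>k\<in>UNIV. c $ k * e k p f)) $ j"

definition sasakian_frame ::
  "'m atlas \<Rightarrow> nat \<Rightarrow> real \<Rightarrow> 'm vfield \<Rightarrow> 'm metric \<Rightarrow> (3 \<Rightarrow> 'm vfield) \<Rightarrow> bool" where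
  "sasakian_frame C r H \<xi> g e \<longleftrightarrow>
     global_frame C e \<and> e 1 = \<xi> \<and>
     (\<forall>p i j. g p (e i p) (e j p) = (if i = j then hsign r i else 0)) \<and>
     lie_bracket (e 1) (e 2) = (\<lambda>p f. - ((H + (-1) ^ r * 3) / 2) * e 3 p f) \<and>
     lie_bracket (e 1) (e 3) = (\<lambda>p f. (H + (-1) ^ r * 3) / 2 * e 2 p f) \<and>
     lie_bracket (e 2) (e 3) = (\<lambda>p f. - 2 * e 1 p f)"

definition ricci :: "'m connection \<Rightarrow> (3 \<Rightarrow> 'm vfield) \<Rightarrow> 'm vfield \<Rightarrow> 'm vfield \<Rightarrow> 'm \<Rightarrow> real" where
  "ricci nab e X Y p = (\<Sum>j\<in>UNIV. coframe e j p (curvature nab (e j) X Y p))"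

type_synonym 'm spinor = "'m \<Rightarrow> complex^2"

definition pauli :: "3 \<Rightarrow> complex^2^2" where
  "pauli j = (if j = 1 then vector [vector [0, 1], vector [1, 0]]
     else if j = 2 then vector [vector [0, - \<i>], vector [\<i>, 0]]
     else vector [vector [1, 0], vector [0, - 1]])"

text \<open>\<open>mat c ** A\<close> is the scalar multiple \<open>c A\<close>.\<close>

definition gamma :: "nat \<Rightarrow> 3 \<Rightarrow> complex^2^2" where
  "gamma r j = mat (if j = 1 then (- \<i>) powi (int r - 1) else \<i>) ** pauli j"

definition gamma_up :: "nat \<Rightarrow> 3 \<Rightarrow> complex^2^2" where
  "gamma_up r j = mat (of_real (hsign r j)) ** gamma r j"

definition spinor_fields :: "'m atlas \<Rightarrow> 'm spinor set" where
  "spinor_fields C = {\<psi>. \<forall>i. (\<lambda>p. Re (\<psi> p $ i)) \<in> smooth_functions C \<and>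
                            (\<lambda>p. Im (\<psi> p $ i)) \<in> smooth_functions C}"

definition spinor_deriv :: "'m vfield \<Rightarrow> 'm spinor \<Rightarrow> 'm spinor" where
  "spinor_deriv X \<psi> p = (\<chi> i. Complex (X p (\<lambda>q. Re (\<psi> q $ i))) (X p (\<lambda>q. Im (\<psi> q $ i))))"

definition clifford :: "nat \<Rightarrow> (3 \<Rightarrow> 'm vfield) \<Rightarrow> 'm vfield \<Rightarrow> 'm spinor \<Rightarrow> 'm spinor" where
  "clifford r e X \<psi> p = (\<Sum>j\<in>UNIV. of_real (coframe e j p (X p)) *s (gamma r j *v \<psi> p))"

definition spin_nabla ::
  "nat \<Rightarrow> real \<Rightarrow> (3 \<Rightarrow> 'm vfield) \<Rightarrow> 'm vfield \<Rightarrow> 'm spinor \<Rightarrow> 'm spinor" where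
  "spin_nabla r H e X \<psi> p =
     spinor_deriv X \<psi> p
     + ((- \<i>) ^ r / 2) *s (\<Sum>j\<in>UNIV. of_real (coframe e j p (X p)) *s (gamma r j *v \<psi> p))
     + (\<i> ^ r * of_real ((H + (-1) powi (int r - 1)) / 4) * of_real (coframe e 1 p (X p)))
         *s (gamma r 1 *v \<psi> p)"

definition spin_form :: "nat \<Rightarrow> complex^2 \<Rightarrow> complex^2 \<Rightarrow> complex" where
  "spin_form r \<psi>\<^sub>1 \<psi>\<^sub>2 = (\<Sum>i\<in>UNIV. cnj (\<psi>\<^sub>1 $ i) * ((((*v) (gamma r 1)) ^^ r) \<psi>\<^sub>2) $ i)"

definition sqk_spinor ::
  "'m atlas \<Rightarrow> nat \<Rightarrow> real \<Rightarrow> 'm vfield \<Rightarrow> 'm form1 \<Rightarrow> (3 \<Rightarrow> 'm vfield) \<Rightarrow> real \<Rightarrow> real \<Rightarrow>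
   'm spinor \<Rightarrow> bool" where
  "sqk_spinor C r H \<xi> \<eta> e a b \<psi> \<longleftrightarrow>
     \<psi> \<in> spinor_fields C \<and>
     (\<forall>X\<in>vector_fields C. \<forall>p. spin_nabla r H e X \<psi> p =
        (of_real a * \<i> ^ r) *s clifford r e X \<psi> p
        + (of_real b * \<i> ^ r * of_real (\<eta> p (X p))) *s clifford r e \<xi> \<psi> p)"

text \<open>The gauge field is \<open>\<i> A\<close> with \<open>A\<close> a real one-form; \<open>q\<close> is the charge.\<close>

definition gauge_nabla ::
  "nat \<Rightarrow> real \<Rightarrow> (3 \<Rightarrow> 'm vfield) \<Rightarrow> real \<Rightarrow> 'm form1 \<Rightarrow> 'm vfield \<Rightarrow> 'm spinor \<Rightarrow> 'm spinor" where
  "gauge_nabla r H e q A X \<psi> p =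
     spin_nabla r H e X \<psi> p + (of_real q * \<i> * of_real (A p (X p))) *s \<psi> p"

definition gauge_dirac ::
  "nat \<Rightarrow> real \<Rightarrow> (3 \<Rightarrow> 'm vfield) \<Rightarrow> real \<Rightarrow> 'm form1 \<Rightarrow> 'm spinor \<Rightarrow> 'm spinor" where
  "gauge_dirac r H e q A \<psi> p =
     (\<i> ^ r) *s (\<Sum>j\<in>UNIV. gamma_up r j *v gauge_nabla r H e q A (e j) \<psi> p)"

definition dirac_equation ::
  "nat \<Rightarrow> real \<Rightarrow> (3 \<Rightarrow> 'm vfield) \<Rightarrow> real \<Rightarrow> 'm form1 \<Rightarrow> 'm spinor \<Rightarrow> bool" where
  "dirac_equation r H e q A \<psi> \<longleftrightarrow>
     (\<exists>l::real. \<forall>p. gauge_dirac r H e q A \<psi> p = of_real l *s \<psi> p)"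

type_synonym 'm form2 = "'m vfield \<Rightarrow> 'm vfield \<Rightarrow> 'm \<Rightarrow> real"

definition nabla_form2 ::
  "'m connection \<Rightarrow> 'm form2 \<Rightarrow> 'm vfield \<Rightarrow> 'm vfield \<Rightarrow> 'm vfield \<Rightarrow> 'm \<Rightarrow> real" where
  "nabla_form2 nab F X Y Z p = X p (F Y Z) - F (nab X Y) Z p - F Y (nab X Z) p"

definition star_d_star :: "nat \<Rightarrow> 'm connection \<Rightarrow> (3 \<Rightarrow> 'm vfield) \<Rightarrow> 'm form2 \<Rightarrow> 'm form1" where
  "star_d_star r nab e F p v = (-1) powi (int r - 1) *
     (\<Sum>k\<in>UNIV. (\<Sum>j\<in>UNIV. hsign r j * nabla_form2 nab F (e j) (e j) (e k) p) * coframe e k p v)"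

text \<open>The coefficients of \<open>J\<^sub>\<psi>\<close> are real, but they are given by a complex expression; the Maxwell
  equation is therefore stated as an equality of complex numbers, which loses nothing.\<close>

definition current_flat ::
  "nat \<Rightarrow> 'm metric \<Rightarrow> (3 \<Rightarrow> 'm vfield) \<Rightarrow> 'm spinor \<Rightarrow> 'm \<Rightarrow> 'm tvec \<Rightarrow> complex" where
  "current_flat r g e \<psi> p v = (- \<i>) powi (int r - 1) *
     (\<Sum>j\<in>UNIV. spin_form r (\<psi> p) (gamma_up r j *v \<psi> p) * of_real (g p (e j p) v))"

definition maxwell_equation ::
  "'m atlas \<Rightarrow> nat \<Rightarrow> 'm metric \<Rightarrow> 'm connection \<Rightarrow> (3 \<Rightarrow> 'm vfield) \<Rightarrow> real \<Rightarrow> 'm form1 \<Rightarrow>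
   'm spinor \<Rightarrow> bool" where
  "maxwell_equation C r g nab e q A \<psi> \<longleftrightarrow>
     (\<forall>p. \<forall>v\<in>tangent_space C p.
        of_real (star_d_star r nab e (ext_deriv A) p v) = of_real q * current_flat r g e \<psi> p v)"

definition T_em :: "nat \<Rightarrow> 'm metric \<Rightarrow> (3 \<Rightarrow> 'm vfield) \<Rightarrow> 'm form2 \<Rightarrow> 'm form2" where
  "T_em r g e F X Y p =
     (\<Sum>j\<in>UNIV. hsign r j * F X (e j) p * F Y (e j) p)
     - 1 / 4 * (\<Sum>j\<in>UNIV. \<Sum>k\<in>UNIV. hsign r j * hsign r k * (F (e j) (e k) p)\<^sup>2)
       * g p (X p) (Y p)"

definition T_spin ::
  "nat \<Rightarrow> real \<Rightarrow> (3 \<Rightarrow> 'm vfield) \<Rightarrow> real \<Rightarrow> 'm form1 \<Rightarrow> 'm spinor \<Rightarrow> 'm form2" where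
  "T_spin r H e q A \<psi> X Y p = 1 / 4 * Re (spin_form r (\<psi> p)
     ((\<i> ^ r) *s (clifford r e X (gauge_nabla r H e q A Y \<psi>) p
                + clifford r e Y (gauge_nabla r H e q A X \<psi>) p)))"

definition trace_form :: "nat \<Rightarrow> (3 \<Rightarrow> 'm vfield) \<Rightarrow> 'm form2 \<Rightarrow> 'm \<Rightarrow> real" where
  "trace_form r e T p = (\<Sum>j\<in>UNIV. hsign r j * T (e j) (e j) p)"

definition einstein_equation ::
  "'m atlas \<Rightarrow> nat \<Rightarrow> real \<Rightarrow> 'm metric \<Rightarrow> 'm connection \<Rightarrow> (3 \<Rightarrow> 'm vfield) \<Rightarrow> real \<Rightarrow> 'm form1 \<Rightarrow>
   'm spinor \<Rightarrow> real \<Rightarrow> bool" where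
  "einstein_equation C r H g nab e q A \<psi> \<Lambda> \<longleftrightarrow>
     (let T = (\<lambda>X Y p. T_em r g e (ext_deriv A) X Y p + T_spin r H e q A \<psi> X Y p) in
      \<forall>X\<in>vector_fields C. \<forall>Y\<in>vector_fields C. \<forall>p.
        ricci nab e X Y p =
          T X Y p - trace_form r e T p * g p (X p) (Y p) + 2 * \<Lambda> * g p (X p) (Y p))"

definition DM_system ::
  "'m atlas \<Rightarrow> nat \<Rightarrow> real \<Rightarrow> 'm metric \<Rightarrow> 'm connection \<Rightarrow> (3 \<Rightarrow> 'm vfield) \<Rightarrow> real \<Rightarrow> 'm form1 \<Rightarrow>
   'm spinor \<Rightarrow> bool" where
  "DM_system C r H g nab e q A \<psi> \<longleftrightarrow>
     dirac_equation r H e q A \<psi> \<and> maxwell_equation C r g nab e q A \<psi>"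

definition EDM_system ::
  "'m atlas \<Rightarrow> nat \<Rightarrow> real \<Rightarrow> 'm metric \<Rightarrow> 'm connection \<Rightarrow> (3 \<Rightarrow> 'm vfield) \<Rightarrow> real \<Rightarrow> 'm form1 \<Rightarrow>
   'm spinor \<Rightarrow> real \<Rightarrow> bool" where
  "EDM_system C r H g nab e q A \<psi> \<Lambda> \<longleftrightarrow>
     DM_system C r H g nab e q A \<psi> \<and> einstein_equation C r H g nab e q A \<psi> \<Lambda>"

end

theory Submission
  imports Defs
begin

text \<open>An SqK-spinor turns every covariant derivative in the field equations into Clifford algebra: in
  the Sasakian frame the eigenvalue condition forces \<open>\<psi> = (x, \<tau> x)\<close>, so the Dirac equation, the
  current and \<open>T\<^sup>s\<^sup>p\<^sup>i\<^sup>n\<close> are pointwise identities in \<open>\<complex>\<^sup>2\<close>. On the geometric side \<open>d\<eta>\<close> is a tensor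
  because \<open>d\<eta>(X, Y) = 2 g(X, \<phi> Y)\<close>, and the brackets of the frame determine the Levi-Civita
  connection, hence \<open>Ric\<close> and \<open>*d*F\<close>, with constant coefficients. Both the energy-momentum tensor and
  \<open>Ric\<close> are then diagonal in the frame, and the Einstein equation reduces to two scalar equations for
  \<open>H\<close> and \<open>\<Lambda>\<close>.\<close>

section \<open>Smooth functions and vector fields\<close>

text \<open>On an open set the Frechet derivative at a point depends only on nearby values, so
  agreement on \<open>S\<close> passes to the partial derivatives and the induction
  proceeds.\<close>

lemma Ck_on_cong:
  assumes "open S" "\<And>x. x \<in> S \<Longrightarrow> f x = g x" "Ck_on k S f"
  shows "Ck_on k S g"
  using assms(2,3)
proof (induction k arbitrary: f g)
  case 0
  then show ?case using continuous_on_cong[of S S f g] by simp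
next
  case (Suc k)
  have d: "g differentiable (at x)" if "x \<in> S" for x
    using Suc.prems that assms(1)
    by (meson Ck_on.simps(2) differentiable_def has_derivative_transform_within_open)
  have "frechet_derivative f (at x) = frechet_derivative g (at x)" if "x \<in> S" for x
    using Suc.prems that assms(1)
    by (intro frechet_derivative_transform_within_open[of f x S g]) auto
  then have "Ck_on k S (\<lambda>x. frechet_derivative g (at x) b)" if "b \<in> Basis" for b
    using Suc.IH[of "\<lambda>x. frechet_derivative f (at x) b" "\<lambda>x. frechet_derivative g (at x) b"]
      Suc.prems that by simp
  with d show ?case by simp
qed

lemma Ck_on_Suc_imp_Ck_on: "Ck_on (Suc k) S f \<Longrightarrow> Ck_on k S f"
proof (induction k arbitrary: f)
  case 0
  then show ?case
    by (auto intro!: continuous_at_imp_continuous_on differentiable_imp_continuous_within)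
next
  case (Suc k)
  show ?case
    using Suc.prems Suc.IH by (auto simp del: Ck_on.simps simp: Ck_on.simps(2))
qed

lemma Ck_on_const: "Ck_on k S (\<lambda>x. c)"
  by (induction k arbitrary: c) (auto simp: frechet_derivative_const)

lemma Ck_on_add:
  assumes "open S"
  shows "Ck_on k S f \<Longrightarrow> Ck_on k S g \<Longrightarrow> Ck_on k S (\<lambda>x. f x + g x)"
proof (induction k arbitrary: f g)
  case 0
  then show ?case by (simp add: continuous_on_add)
next
  case (Suc k)
  have "Ck_on k S (\<lambda>x. frechet_derivative (\<lambda>x. f x + g x) (at x) b)" if b: "b \<in> Basis" for b
  \<comment> \<open>The sum rule is available only at points of \<open>S\<close>, where both
    summands are differentiable, so the derivative is replaced by its formula on \<open>S\<close>
    alone.\<close>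
  proof (rule Ck_on_cong[OF assms(1)])
    show "Ck_on k S (\<lambda>x. frechet_derivative f (at x) b + frechet_derivative g (at x) b)"
      using Suc.prems b by (intro Suc.IH) auto
    fix x assume "x \<in> S"
    then show "frechet_derivative f (at x) b + frechet_derivative g (at x) b
        = frechet_derivative (\<lambda>x. f x + g x) (at x) b"
      using Suc.prems has_derivative_add
      by (intro fun_cong[OF frechet_derivative_at]) (fastforce simp: frechet_derivative_works)
  qed
  then show ?case using Suc.prems by (auto intro: differentiable_add)
qed

lemma Ck_on_mult:
  fixes f g :: "'a::euclidean_space \<Rightarrow> real"
  assumes "open S"
  shows "Ck_on k S f \<Longrightarrow> Ck_on k S g \<Longrightarrow> Ck_on k S (\<lambda>x. f x * g x)"
proof (induction k arbitrary: f g)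
  case 0
  then show ?case by (simp add: continuous_on_mult)
next
  case (Suc k)
  \<comment> \<open>The Leibniz rule keeps one factor undifferentiated, and the induction hypothesis
    wants that factor at order \<open>k\<close>.\<close>
  have fg: "Ck_on k S f" "Ck_on k S g" using Suc.prems Ck_on_Suc_imp_Ck_on by auto
  have "Ck_on k S (\<lambda>x. frechet_derivative (\<lambda>x. f x * g x) (at x) b)" if b: "b \<in> Basis" for b
  proof (rule Ck_on_cong[OF assms(1)])
    show "Ck_on k S (\<lambda>x. f x * frechet_derivative g (at x) b + frechet_derivative f (at x) b * g x)"
      using Suc.prems b fg by (intro Ck_on_add[OF assms] Suc.IH) auto
    fix x assume "x \<in> S"
    then show "f x * frechet_derivative g (at x) b + frechet_derivative f (at x) b * g x
        = frechet_derivative (\<lambda>x. f x * g x) (at x) b"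
      using Suc.prems has_derivative_mult
      by (intro fun_cong[OF frechet_derivative_at]) (fastforce simp: frechet_derivative_works)
  qed
  then show ?case using Suc.prems by (auto intro: differentiable_mult)
qed

section \<open>The algebra of smooth functions and its derivations\<close>

lemma smooth_functions_const: "(\<lambda>p. c) \<in> smooth_functions C"
  by (auto simp: smooth_functions_def smooth_on_def o_def Ck_on_const)

lemma open_chart_image: "smooth_manifold3 C \<Longrightarrow> (U, x) \<in> C \<Longrightarrow> open (x ` U)"
  unfolding smooth_manifold3_def by blast

lemma smooth_functions_add:
  assumes "smooth_manifold3 C" "f \<in> smooth_functions C" "g \<in> smooth_functions C"
  shows "(\<lambda>p. f p + g p) \<in> smooth_functions C"
  using assms Ck_on_add[OF open_chart_image[OF assms(1)]]
  by (fastforce simp: smooth_functions_def smooth_on_def o_def)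

lemma smooth_functions_mult:
  assumes "smooth_manifold3 C" "f \<in> smooth_functions C" "g \<in> smooth_functions C"
  shows "(\<lambda>p. f p * g p) \<in> smooth_functions C"
  using assms Ck_on_mult[OF open_chart_image[OF assms(1)]]
  by (fastforce simp: smooth_functions_def smooth_on_def o_def)

lemma tangent_space_mult:
  "v \<in> tangent_space C p \<Longrightarrow> f \<in> smooth_functions C \<Longrightarrow> g \<in> smooth_functions C \<Longrightarrow>
    v (\<lambda>q. f q * g q) = v f * g p + f p * v g"
  by (simp add: tangent_space_def)

lemma tangent_space_scale:
  "v \<in> tangent_space C p \<Longrightarrow> f \<in> smooth_functions C \<Longrightarrow> v (\<lambda>q. c * f q) = c * v f"
  by (simp add: tangent_space_def)

lemma tangent_space_const:
  assumes "v \<in> tangent_space C p"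
  shows "v (\<lambda>q. c) = 0"
proof -
  \<comment> \<open>Leibniz applied to 1 = 1 * 1 gives v(1) = 2 v(1), hence v(1) = 0; homogeneity
    then handles every constant.\<close>
  have "v (\<lambda>q. 1 * 1) = v (\<lambda>q. 1) * 1 + 1 * v (\<lambda>q. 1)"
    by (rule tangent_space_mult[OF assms]) (rule smooth_functions_const)+
  then have "v (\<lambda>q. 1) = 0" by simp
  moreover have "v (\<lambda>q. c * 1) = c * v (\<lambda>q. 1)"
    using assms smooth_functions_const by (rule tangent_space_scale[where f="\<lambda>q. 1"])
  ultimately show ?thesis by simp
qed

lemma tangent_space_lincomb:
  assumes "v \<in> tangent_space C p" "w \<in> tangent_space C p"
  shows "(\<lambda>f. a * v f + b * w f) \<in> tangent_space C p"
  using assms unfolding tangent_space_def by (auto simp: algebra_simps)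

text \<open>Naming the pointwise operations turns the rules for \<open>nab\<close>, brackets and
  curvature into plain rewrite rules, without matching under binders.\<close>

definition vf_add :: "'m vfield \<Rightarrow> 'm vfield \<Rightarrow> 'm vfield" where
  "vf_add X Y = (\<lambda>p f. X p f + Y p f)"

definition vf_scale :: "('m \<Rightarrow> real) \<Rightarrow> 'm vfield \<Rightarrow> 'm vfield" where
  "vf_scale u X = (\<lambda>p f. u p * X p f)"

lemma vector_fields_tangent: "X \<in> vector_fields C \<Longrightarrow> X p \<in> tangent_space C p"
  by (simp add: vector_fields_def)

lemma vector_fields_deriv:
  "X \<in> vector_fields C \<Longrightarrow> u \<in> smooth_functions C \<Longrightarrow> (\<lambda>p. X p u) \<in> smooth_functions C"
  by (simp add: vector_fields_def)

lemma vector_fields_lincomb: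
  assumes "smooth_manifold3 C" "X \<in> vector_fields C" "Y \<in> vector_fields C"
    "u \<in> smooth_functions C" "v \<in> smooth_functions C"
  shows "(\<lambda>p f. u p * X p f + v p * Y p f) \<in> vector_fields C"
  using assms
  by (auto simp: vector_fields_def intro!: tangent_space_lincomb smooth_functions_add smooth_functions_mult)

lemma vf_add_in_vector_fields:
  assumes "smooth_manifold3 C" "X \<in> vector_fields C" "Y \<in> vector_fields C"
  shows "vf_add X Y \<in> vector_fields C"
  using vector_fields_lincomb[OF assms smooth_functions_const smooth_functions_const, of 1 1]
  by (simp add: vf_add_def algebra_simps)

lemma vf_scale_in_vector_fields:
  assumes "smooth_manifold3 C" "X \<in> vector_fields C" "u \<in> smooth_functions C"
  shows "vf_scale u X \<in> vector_fields C"
  using vector_fields_lincomb[OF assms(1,2,2,3) smooth_functions_const, of 0]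
  by (simp add: vf_scale_def)

section \<open>Levi-Civita connections\<close>

locale levi_civita_connection =
  fixes C :: "('m::{t2_space,second_countable_topology}) atlas" and g :: "'m metric"
    and nab :: "'m connection"
  assumes manifold: "smooth_manifold3 C" and levi_civita: "levi_civita C g nab"
begin

lemmas vf_intros [intro, simp] =
  vf_add_in_vector_fields[OF manifold] vf_scale_in_vector_fields[OF manifold]
  smooth_functions_const smooth_functions_add[OF manifold] smooth_functions_mult[OF manifold]
  vector_fields_deriv

lemma nab_vector_field [intro, simp]:
  "X \<in> vector_fields C \<Longrightarrow> Y \<in> vector_fields C \<Longrightarrow> nab X Y \<in> vector_fields C"
  using levi_civita by (simp add: levi_civita_def)

lemma nab_lincomb:
  "X \<in> vector_fields C \<Longrightarrow> Y \<in> vector_fields C \<Longrightarrow> Z \<in> vector_fields C \<Longrightarrow>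
   u \<in> smooth_functions C \<Longrightarrow> v \<in> smooth_functions C \<Longrightarrow>
   nab (\<lambda>p f. u p * X p f + v p * Y p f) Z = (\<lambda>p f. u p * nab X Z p f + v p * nab Y Z p f)"
  using levi_civita unfolding levi_civita_def by blast

lemma nab_add_left:
  "X \<in> vector_fields C \<Longrightarrow> Y \<in> vector_fields C \<Longrightarrow> Z \<in> vector_fields C \<Longrightarrow>
   nab (vf_add X Y) Z = vf_add (nab X Z) (nab Y Z)"
  using nab_lincomb[of X Y Z "\<lambda>p. 1" "\<lambda>p. 1"] by (simp add: vf_add_def algebra_simps)

lemma nab_scale_left:
  "X \<in> vector_fields C \<Longrightarrow> Z \<in> vector_fields C \<Longrightarrow> u \<in> smooth_functions C \<Longrightarrow>
   nab (vf_scale u X) Z = vf_scale u (nab X Z)"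
  using nab_lincomb[of X X Z u "\<lambda>p. 0"] by (simp add: vf_scale_def)

lemma nab_add_right:
  "X \<in> vector_fields C \<Longrightarrow> Y \<in> vector_fields C \<Longrightarrow> Z \<in> vector_fields C \<Longrightarrow>
   nab X (vf_add Y Z) = vf_add (nab X Y) (nab X Z)"
  using levi_civita unfolding levi_civita_def vf_add_def by blast

lemma nab_scale_right:
  "X \<in> vector_fields C \<Longrightarrow> Y \<in> vector_fields C \<Longrightarrow> u \<in> smooth_functions C \<Longrightarrow>
   nab X (vf_scale u Y) = vf_add (vf_scale (\<lambda>p. X p u) Y) (vf_scale u (nab X Y))"
  using levi_civita unfolding levi_civita_def vf_add_def vf_scale_def by blast

lemma nab_scale_const_right:
  assumes "X \<in> vector_fields C" "Y \<in> vector_fields C"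
  shows "nab X (vf_scale (\<lambda>p. c) Y) = vf_scale (\<lambda>p. c) (nab X Y)"
  using nab_scale_right[OF assms, of "\<lambda>p. c"]
  by (simp add: vf_add_def vf_scale_def tangent_space_const[OF vector_fields_tangent[OF assms(1)]])

lemma nab_torsion_free:
  "X \<in> vector_fields C \<Longrightarrow> Y \<in> vector_fields C \<Longrightarrow>
   (\<lambda>p f. nab X Y p f - nab Y X p f) = lie_bracket X Y"
  using levi_civita unfolding levi_civita_def by blast

lemma nab_metric:
  "X \<in> vector_fields C \<Longrightarrow> Y \<in> vector_fields C \<Longrightarrow> Z \<in> vector_fields C \<Longrightarrow>
   X p (\<lambda>q. g q (Y q) (Z q)) = g p (nab X Y p) (Z p) + g p (Y p) (nab X Z p)"
  using levi_civita unfolding levi_civita_def by blast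

text \<open>Torsion-freeness writes the bracket as a difference of two covariant derivatives, so
  membership follows without expanding commutators of derivations.\<close>

lemma lie_bracket_vector_field [intro, simp]:
  assumes "X \<in> vector_fields C" "Y \<in> vector_fields C"
  shows "lie_bracket X Y \<in> vector_fields C"
proof -
  have "lie_bracket X Y = vf_add (nab X Y) (vf_scale (\<lambda>p. -1) (nab Y X))"
    using nab_torsion_free[OF assms] by (auto simp: vf_add_def vf_scale_def)
  then show ?thesis using assms by simp
qed

lemma lie_bracket_add:
  assumes "A \<in> vector_fields C" "X \<in> vector_fields C" "Y \<in> vector_fields C"
  shows "lie_bracket A (vf_add X Y) = vf_add (lie_bracket A X) (lie_bracket A Y)"
  unfolding nab_torsion_free[symmetric, OF assms(1) vf_add_in_vector_fields[OF manifold assms(2,3)]]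
    nab_torsion_free[symmetric, OF assms(1,2)] nab_torsion_free[symmetric, OF assms(1,3)]
  using assms by (simp add: nab_add_left nab_add_right) (simp add: vf_add_def algebra_simps)

text \<open>Torsion-freeness again: the derivative of \<open>u\<close> comes from
  \<open>nab A (vf_scale u X)\<close>, since \<open>nab\<close> is function-linear in its
  direction.\<close>

lemma lie_bracket_scale:
  assumes "A \<in> vector_fields C" "X \<in> vector_fields C" "u \<in> smooth_functions C"
  shows "lie_bracket A (vf_scale u X) = vf_add (vf_scale (\<lambda>p. A p u) X) (vf_scale u (lie_bracket A X))"
  unfolding nab_torsion_free[symmetric, OF assms(1) vf_scale_in_vector_fields[OF manifold assms(2,3)]]
    nab_torsion_free[symmetric, OF assms(1,2)]
  using assms by (simp add: nab_scale_left nab_scale_right) (simp add: vf_add_def vf_scale_def algebra_simps)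

section \<open>Tensoriality of the curvature in its last two arguments\<close>

lemma curvature_add_middle:
  assumes "A \<in> vector_fields C" "X \<in> vector_fields C" "Y \<in> vector_fields C" "Z \<in> vector_fields C"
  shows "curvature nab A (vf_add X Y) Z = vf_add (curvature nab A X Z) (curvature nab A Y Z)"
  using assms unfolding curvature_def
  by (simp add: lie_bracket_add nab_add_left nab_add_right) (simp add: vf_add_def algebra_simps)

text \<open>The term with the derivative of \<open>u\<close> along \<open>A\<close> arises twice,
  from the outer covariant derivative and from the bracket of \<open>A\<close> with
  \<open>vf_scale u X\<close>, and cancels.\<close>

lemma curvature_scale_middle:
  assumes "A \<in> vector_fields C" "X \<in> vector_fields C" "Z \<in> vector_fields C" "u \<in> smooth_functions C"
  shows "curvature nab A (vf_scale u X) Z = vf_scale u (curvature nab A X Z)"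
  using assms unfolding curvature_def
  by (simp add: lie_bracket_scale nab_add_left nab_scale_left nab_scale_right)
    (simp add: vf_add_def vf_scale_def algebra_simps)

lemma curvature_add_right:
  assumes "A \<in> vector_fields C" "X \<in> vector_fields C" "Y \<in> vector_fields C" "Z \<in> vector_fields C"
  shows "curvature nab A X (vf_add Y Z) = vf_add (curvature nab A X Y) (curvature nab A X Z)"
  using assms unfolding curvature_def
  by (simp add: nab_add_right) (simp add: vf_add_def algebra_simps)

lemma curvature_scale_right:
  assumes "A \<in> vector_fields C" "X \<in> vector_fields C" "Z \<in> vector_fields C" "u \<in> smooth_functions C"
  shows "curvature nab A X (vf_scale u Z) = vf_scale u (curvature nab A X Z)"
proof -
  \<comment> \<open>The mixed first-order terms cancel by symmetry; the second derivatives of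
    \<open>u\<close> leave exactly this commutator, which the bracket term of the curvature
    removes.\<close>
  have "lie_bracket A X p u = A p (\<lambda>q. X q u) - X p (\<lambda>q. A q u)" for p
    by (simp add: lie_bracket_def deriv_along_def)
  then show ?thesis
    using assms unfolding curvature_def
    by (simp add: nab_scale_right nab_add_right) (simp add: vf_add_def vf_scale_def algebra_simps)
qed

end

section \<open>Sasakian frames\<close>

lemma riemannian_metric_lincomb:
  "riemannian_metric C g \<Longrightarrow> u \<in> tangent_space C p \<Longrightarrow> v \<in> tangent_space C p \<Longrightarrow>
    w \<in> tangent_space C p \<Longrightarrow> g p (\<lambda>f. a * u f + b * v f) w = a * g p u w + b * g p v w"
  by (simp add: riemannian_metric_def)

lemma riemannian_metric_commute:
  "riemannian_metric C g \<Longrightarrow> v \<in> tangent_space C p \<Longrightarrow> w \<in> tangent_space C p \<Longrightarrow> g p v w = g p w v"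
  by (simp add: riemannian_metric_def)

lemma contact_metric_endo_tangent:
  "contact_metric C \<phi> \<xi> \<eta> g \<Longrightarrow> v \<in> tangent_space C p \<Longrightarrow> \<phi> p v \<in> tangent_space C p"
  by (simp add: contact_metric_def)

lemma contact_metric_endo_lincomb:
  "contact_metric C \<phi> \<xi> \<eta> g \<Longrightarrow> v \<in> tangent_space C p \<Longrightarrow> w \<in> tangent_space C p \<Longrightarrow>
    \<phi> p (\<lambda>f. a * v f + b * w f) = (\<lambda>f. a * \<phi> p v f + b * \<phi> p w f)"
  by (simp add: contact_metric_def)

lemma contact_metric_ext_deriv:
  "contact_metric C \<phi> \<xi> \<eta> g \<Longrightarrow> X \<in> vector_fields C \<Longrightarrow> Y \<in> vector_fields C \<Longrightarrow>
    ext_deriv \<eta> X Y p = 2 * g p (X p) (\<phi> p (Y p))"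
  by (simp add: contact_metric_def)

lemma contact_metric_riemannian: "contact_metric C \<phi> \<xi> \<eta> g \<Longrightarrow> riemannian_metric C g"
  by (simp add: contact_metric_def)

locale sasakian_frame_geometry = levi_civita_connection C g nab
  for C :: "('m::{t2_space,second_countable_topology}) atlas" and g nab +
  fixes r :: nat and H :: real and \<phi> :: "'m endo" and \<xi> :: "'m vfield" and \<eta> :: "'m form1"
    and e :: "3 \<Rightarrow> 'm vfield"
  assumes r: "r \<in> {0, 1}"
    and pseudo_sasakian: "pseudo_sasakian C r \<phi> \<xi> \<eta> g"
    and frame: "sasakian_frame C r H \<xi> g e"
begin

abbreviation s :: real where "s \<equiv> (-1) ^ r"

section \<open>Components with respect to the frame and its dual coframe\<close>

lemma frame_vector_field [intro, simp]: "e j \<in> vector_fields C"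
  using frame by (simp add: sasakian_frame_def global_frame_def)

lemma frame_tangent [intro, simp]: "e j p \<in> tangent_space C p"
  by (simp add: vector_fields_tangent)

lemma e1: "e 1 = \<xi>"
  using frame by (simp add: sasakian_frame_def)

lemma frame_unique:
  assumes "v \<in> tangent_space C p"
  shows "\<exists>!c :: real^3. v = (\<lambda>f. \<Sum>k\<in>UNIV. c $ k * e k p f)"
  using assms frame unfolding sasakian_frame_def global_frame_def by blast

lemma frame_expansion:
  assumes "v \<in> tangent_space C p"
  shows "v = (\<lambda>f. coframe e 1 p v * e 1 p f + coframe e 2 p v * e 2 p f + coframe e 3 p v * e 3 p f)"
  using theI'[OF frame_unique[OF assms]] unfolding coframe_def sum_3 .

lemma tangent_space_lincomb3:
  assumes "u \<in> tangent_space C p" "v \<in> tangent_space C p" "w \<in> tangent_space C p"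
  shows "(\<lambda>f. a * u f + b * v f + c * w f) \<in> tangent_space C p"
  using tangent_space_lincomb[OF tangent_space_lincomb[OF assms(1,2), of a b] assms(3), of 1 c] by simp

lemma coframe_combination:
  "coframe e j p (\<lambda>f. a * e 1 p f + b * e 2 p f + c * e 3 p f)
     = (if j = 1 then a else if j = 2 then b else c)"
proof -
  let ?v = "\<lambda>f. a * e 1 p f + b * e 2 p f + c * e 3 p f"
  have "?v \<in> tangent_space C p" by (intro tangent_space_lincomb3 frame_tangent)
  moreover have "?v = (\<lambda>f. \<Sum>k\<in>UNIV. (vector [a, b, c] :: real^3) $ k * e k p f)"
    by (simp add: sum_3)
  ultimately have "(THE c :: real^3. ?v = (\<lambda>f. \<Sum>k\<in>UNIV. c $ k * e k p f)) = vector [a, b, c]"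
    by (intro the1_equality frame_unique)
  then show ?thesis unfolding coframe_def using exhaust_3[of j] by auto
qed

lemma coframe_frame: "coframe e j p (e i p) = (if i = j then 1 else 0)"
  using coframe_combination[of j p 1 0 0] coframe_combination[of j p 0 1 0]
    coframe_combination[of j p 0 0 1] exhaust_3[of i] exhaust_3[of j] by auto

text \<open>Linearity for three summands, the number occurring in the definition of the curvature;
  shorter combinations use zero coefficients.\<close>

lemma coframe_lincomb3:
  assumes "u \<in> tangent_space C p" "v \<in> tangent_space C p" "w \<in> tangent_space C p"
  shows "coframe e j p (\<lambda>f. a * u f + b * v f + c * w f)
     = a * coframe e j p u + b * coframe e j p v + c * coframe e j p w"
proof -
  let ?c = "\<lambda>j. a * coframe e j p u + b * coframe e j p v + c * coframe e j p w"
  have "(\<lambda>f. a * u f + b * v f + c * w f) = (\<lambda>f. ?c 1 * e 1 p f + ?c 2 * e 2 p f + ?c 3 * e 3 p f)"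
    by (subst frame_expansion[OF assms(1)], subst frame_expansion[OF assms(2)],
        subst frame_expansion[OF assms(3)]) (simp add: algebra_simps)
  then show ?thesis using coframe_combination[of j p "?c 1" "?c 2" "?c 3"] exhaust_3[of j] by auto
qed

lemma coframe_scale:
  "v \<in> tangent_space C p \<Longrightarrow> coframe e j p (\<lambda>f. a * v f) = a * coframe e j p v"
  using coframe_lincomb3[of v p v v j a 0 0] by simp

lemma coframe_vf_scale:
  "X \<in> vector_fields C \<Longrightarrow> coframe e j p (vf_scale u X p) = u p * coframe e j p (X p)"
  by (simp add: vf_scale_def coframe_scale vector_fields_tangent)

lemma coframe_vf_add:
  "X \<in> vector_fields C \<Longrightarrow> Y \<in> vector_fields C \<Longrightarrow>
     coframe e j p (vf_add X Y p) = coframe e j p (X p) + coframe e j p (Y p)"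
  using coframe_lincomb3[of "X p" p "Y p" "X p" j 1 1 0] by (simp add: vf_add_def vector_fields_tangent)

text \<open>The factor \<open>1 - s\<close> is 0 in the Riemannian case and 2 in the Lorentzian one,
  so one formula relates \<open>g\<close> to a Riemannian contact metric in both signatures.\<close>

lemma underlying_contact_metric:
  obtains g' where "contact_metric C \<phi> \<xi> \<eta> g'"
    "\<And>p v w. v \<in> tangent_space C p \<Longrightarrow> w \<in> tangent_space C p \<Longrightarrow>
       g p v w = g' p v w - (1 - s) * \<eta> p v * \<eta> p w"
  using pseudo_sasakian unfolding pseudo_sasakian_def sasakian_def by auto

text \<open>Reduces any linear functional on the tangent space to its three values on the frame; it
  is applied to \<open>\<eta>\<close>, to the metric and to the bilinear form behind the exterior
  derivative of \<open>\<eta>\<close>.\<close>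

lemma linear_frame_expansion:
  fixes L :: "'m tvec \<Rightarrow> real"
  assumes "\<And>u v a b. u \<in> tangent_space C p \<Longrightarrow> v \<in> tangent_space C p \<Longrightarrow>
      L (\<lambda>f. a * u f + b * v f) = a * L u + b * L v"
    and "v \<in> tangent_space C p"
  shows "L v = coframe e 1 p v * L (e 1 p) + coframe e 2 p v * L (e 2 p) + coframe e 3 p v * L (e 3 p)"
proof -
  let ?a = "\<lambda>j. coframe e j p v"
  let ?w = "\<lambda>f. ?a 1 * e 1 p f + ?a 2 * e 2 p f"
  have "L v = L (\<lambda>f. 1 * ?w f + ?a 3 * e 3 p f)"
    using frame_expansion[OF assms(2)] by simp
  also have "\<dots> = 1 * L ?w + ?a 3 * L (e 3 p)"
    by (intro assms(1) tangent_space_lincomb frame_tangent)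
  also have "L ?w = ?a 1 * L (e 1 p) + ?a 2 * L (e 2 p)"
    by (intro assms(1) frame_tangent)
  finally show ?thesis by simp
qed

section \<open>The contact form and the metric in the frame\<close>

lemma eta_lincomb:
  "v \<in> tangent_space C p \<Longrightarrow> w \<in> tangent_space C p \<Longrightarrow>
     \<eta> p (\<lambda>f. a * v f + b * w f) = a * \<eta> p v + b * \<eta> p w"
  by (rule underlying_contact_metric) (simp add: contact_metric_def one_form_def)

lemma eta_smooth [intro, simp]: "X \<in> vector_fields C \<Longrightarrow> (\<lambda>p. \<eta> p (X p)) \<in> smooth_functions C"
  by (rule underlying_contact_metric) (simp add: contact_metric_def one_form_def)

lemma metric_frame: "g p (e i p) (e j p) = (if i = j then hsign r i else 0)"
  using frame unfolding sasakian_frame_def by blast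

lemma eta_frame: "\<eta> p (e j p) = (if j = 1 then 1 else 0)"
proof -
  obtain g' where g': "contact_metric C \<phi> \<xi> \<eta> g'"
    and g: "\<And>p v w. v \<in> tangent_space C p \<Longrightarrow> w \<in> tangent_space C p \<Longrightarrow>
       g p v w = g' p v w - (1 - s) * \<eta> p v * \<eta> p w"
    by (rule underlying_contact_metric) (rule that)
  have xi: "\<eta> p (e 1 p) = 1" "g' p (e j p) (e 1 p) = \<eta> p (e j p)"
    using g' e1 frame_tangent[of j p] unfolding contact_metric_def by auto
  \<comment> \<open>Since g'(e_j, \<xi>) = \<eta>(e_j) and \<eta>(\<xi>) = 1, the correction by
    \<open>1 - s\<close> leaves the factor \<open>s\<close>; orthogonality of the frame then kills
    \<eta>(e_2) and \<eta>(e_3).\<close>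
  then have "g p (e j p) (e 1 p) = s * \<eta> p (e j p)"
    by (simp add: g algebra_simps)
  then show ?thesis using xi metric_frame[of p j 1] by (auto split: if_splits)
qed

lemma eta_eq_coframe: "v \<in> tangent_space C p \<Longrightarrow> \<eta> p v = coframe e 1 p v"
  using linear_frame_expansion[of p "\<eta> p" v] by (simp add: eta_lincomb eta_frame)

text \<open>Linearity, like the symmetry below, is inherited from g' and \<eta>, which covers the
  indefinite metric too.\<close>

lemma metric_lincomb_left:
  assumes "u \<in> tangent_space C p" "v \<in> tangent_space C p" "w \<in> tangent_space C p"
  shows "g p (\<lambda>f. a * u f + b * v f) w = a * g p u w + b * g p v w"
proof -
  obtain g' where g': "contact_metric C \<phi> \<xi> \<eta> g'"
    and g: "\<And>p v w. v \<in> tangent_space C p \<Longrightarrow> w \<in> tangent_space C p \<Longrightarrow>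
       g p v w = g' p v w - (1 - s) * \<eta> p v * \<eta> p w"
    by (rule underlying_contact_metric) (rule that)
  have "g' p (\<lambda>f. a * u f + b * v f) w = a * g' p u w + b * g' p v w"
    using assms by (rule riemannian_metric_lincomb[OF contact_metric_riemannian[OF g']])
  then show ?thesis
    using assms by (simp add: g tangent_space_lincomb eta_lincomb algebra_simps)
qed

lemma metric_commute:
  assumes "v \<in> tangent_space C p" "w \<in> tangent_space C p"
  shows "g p v w = g p w v"
proof -
  obtain g' where g': "contact_metric C \<phi> \<xi> \<eta> g'"
    and g: "\<And>p v w. v \<in> tangent_space C p \<Longrightarrow> w \<in> tangent_space C p \<Longrightarrow>
       g p v w = g' p v w - (1 - s) * \<eta> p v * \<eta> p w"
    by (rule underlying_contact_metric) (rule that)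
  have "g' p v w = g' p w v"
    using assms by (rule riemannian_metric_commute[OF contact_metric_riemannian[OF g']])
  then show ?thesis using assms by (simp add: g)
qed

lemma metric_frame_left: "v \<in> tangent_space C p \<Longrightarrow> g p v (e j p) = hsign r j * coframe e j p v"
  using linear_frame_expansion[of p "\<lambda>v. g p v (e j p)" v] exhaust_3[of j]
  by (auto simp: metric_lincomb_left metric_frame)

lemma metric_eq:
  assumes "v \<in> tangent_space C p" "w \<in> tangent_space C p"
  shows "g p v w = s * coframe e 1 p v * coframe e 1 p w + coframe e 2 p v * coframe e 2 p w
    + coframe e 3 p v * coframe e 3 p w"
  using linear_frame_expansion[of p "\<lambda>v. g p v w" v] assms
  by (simp add: metric_lincomb_left metric_commute[OF frame_tangent assms(2)] metric_frame_left hsign_def)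

text \<open>The definite description in \<open>coframe\<close> hides smoothness. The first component
  is \<eta>(X); the other two are g'(X, e_j), because \<eta>(e_j) = 0 there makes g and g'
  agree.\<close>

lemma coframe_smooth [intro, simp]:
  assumes X: "X \<in> vector_fields C"
  shows "(\<lambda>p. coframe e j p (X p)) \<in> smooth_functions C"
proof -
  obtain g' where g': "contact_metric C \<phi> \<xi> \<eta> g'"
    and g: "\<And>p v w. v \<in> tangent_space C p \<Longrightarrow> w \<in> tangent_space C p \<Longrightarrow>
       g p v w = g' p v w - (1 - s) * \<eta> p v * \<eta> p w"
    by (rule underlying_contact_metric) (rule that)
  have sm: "(\<lambda>p. g' p (X p) (e j p)) \<in> smooth_functions C"
    using g' X unfolding contact_metric_def riemannian_metric_def by auto
  show ?thesis
  proof (cases "j = 1")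
    case True
    then show ?thesis using eta_smooth[OF X] by (simp add: eta_eq_coframe vector_fields_tangent X)
  next
    case False
    then have "g' p (X p) (e j p) = coframe e j p (X p)" for p
      using metric_frame_left[OF vector_fields_tangent[OF X], of p j]
        g[OF vector_fields_tangent[OF X] frame_tangent, of p j] by (simp add: eta_frame hsign_def)
    then show ?thesis using sm by simp
  qed
qed

section \<open>Brackets of the frame and the exterior derivative of the contact form\<close>

definition bracket_coeff :: real where "bracket_coeff = (H + s * 3) / 2"

lemma bracket_frame:
  "lie_bracket (e 1) (e 2) = (\<lambda>p f. - bracket_coeff * e 3 p f)"
  "lie_bracket (e 1) (e 3) = (\<lambda>p f. bracket_coeff * e 2 p f)"
  "lie_bracket (e 2) (e 3) = (\<lambda>p f. - 2 * e 1 p f)"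
  using frame unfolding sasakian_frame_def bracket_coeff_def by auto

lemma lie_bracket_commute: "lie_bracket X Y = (\<lambda>p f. - lie_bracket Y X p f)"
  by (simp add: lie_bracket_def)

text \<open>Even the zero field is written as a multiple of a frame field, so that the scaling rules
  rewrite every bracket uniformly.\<close>

lemma lie_bracket_frame:
  "lie_bracket (e 1) (e 2) = vf_scale (\<lambda>_. - bracket_coeff) (e 3)"
  "lie_bracket (e 2) (e 1) = vf_scale (\<lambda>_. bracket_coeff) (e 3)"
  "lie_bracket (e 1) (e 3) = vf_scale (\<lambda>_. bracket_coeff) (e 2)"
  "lie_bracket (e 3) (e 1) = vf_scale (\<lambda>_. - bracket_coeff) (e 2)"
  "lie_bracket (e 2) (e 3) = vf_scale (\<lambda>_. - 2) (e 1)"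
  "lie_bracket (e 3) (e 2) = vf_scale (\<lambda>_. 2) (e 1)"
  "lie_bracket (e i) (e i) = vf_scale (\<lambda>_. 0) (e 1)"
  using bracket_frame lie_bracket_commute[of "e 2" "e 1"] lie_bracket_commute[of "e 3" "e 1"]
    lie_bracket_commute[of "e 3" "e 2"] by (auto simp: lie_bracket_def vf_scale_def)

lemma ext_deriv_eta_frame:
  "ext_deriv \<eta> (e i) (e j) p = (if i = 2 \<and> j = 3 then 2 else if i = 3 \<and> j = 2 then -2 else 0)"
proof -
  \<comment> \<open>The components of \<eta> are constant in the frame, so only the bracket term of
    \<open>ext_deriv\<close> survives.\<close>
  have d: "e i p (\<lambda>q. \<eta> q (e j q)) = 0" for i j
    by (simp add: eta_frame tangent_space_const[OF frame_tangent])
  have "ext_deriv \<eta> (e i) (e j) p = - coframe e 1 p (lie_bracket (e i) (e j) p)"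
    unfolding ext_deriv_def d
    by (simp add: eta_eq_coframe[OF vector_fields_tangent[OF lie_bracket_vector_field]])
  then show ?thesis
    using exhaust_3[of i] exhaust_3[of j]
    by (elim disjE) (simp_all add: lie_bracket_frame coframe_vf_scale coframe_frame)
qed

lemma ext_deriv_eta:
  assumes X: "X \<in> vector_fields C" and Y: "Y \<in> vector_fields C"
  shows "ext_deriv \<eta> X Y p =
    2 * (coframe e 2 p (X p) * coframe e 3 p (Y p) - coframe e 3 p (X p) * coframe e 2 p (Y p))"
proof -
  obtain g' where g': "contact_metric C \<phi> \<xi> \<eta> g'"
    by (rule underlying_contact_metric) (rule that)
  note rm = contact_metric_riemannian[OF g']
  note phi = contact_metric_endo_tangent[OF g']
  \<comment> \<open>The compatibility of contact metric and \<phi> expresses the exterior derivative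
    by a pointwise bilinear form. Its values on the frame therefore determine it on all vector
    fields.\<close>
  define b where "b v w = 2 * g' p v (\<phi> p w)" for v w
  have b1: "b (\<lambda>f. \<alpha> * u f + \<beta> * v f) w = \<alpha> * b u w + \<beta> * b v w"
    if "u \<in> tangent_space C p" "v \<in> tangent_space C p" "w \<in> tangent_space C p" for u v w \<alpha> \<beta>
    using that by (simp add: b_def riemannian_metric_lincomb[OF rm] phi algebra_simps)
  have b2: "b w (\<lambda>f. \<alpha> * u f + \<beta> * v f) = \<alpha> * b w u + \<beta> * b w v"
    if "u \<in> tangent_space C p" "v \<in> tangent_space C p" "w \<in> tangent_space C p" for u v w \<alpha> \<beta>
    using that by (simp add: b_def contact_metric_endo_lincomb[OF g'] phi tangent_space_lincomb
        riemannian_metric_commute[OF rm, of w] riemannian_metric_lincomb[OF rm] algebra_simps)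
  have be: "b (e i p) (e j p) = (if i = 2 \<and> j = 3 then 2 else if i = 3 \<and> j = 2 then -2 else 0)" for i j
    using contact_metric_ext_deriv[OF g', of "e i" "e j"] ext_deriv_eta_frame[of i j p]
    by (simp add: b_def)
  have XY: "X p \<in> tangent_space C p" "Y p \<in> tangent_space C p"
    using X Y by (simp_all add: vector_fields_tangent)
  have "b (e i p) (Y p) = coframe e 1 p (Y p) * b (e i p) (e 1 p) + coframe e 2 p (Y p) * b (e i p) (e 2 p)
      + coframe e 3 p (Y p) * b (e i p) (e 3 p)" for i
    by (rule linear_frame_expansion[of p "b (e i p)"]) (simp_all add: b2 XY)
  moreover have "b (X p) (Y p) = coframe e 1 p (X p) * b (e 1 p) (Y p)
      + coframe e 2 p (X p) * b (e 2 p) (Y p) + coframe e 3 p (X p) * b (e 3 p) (Y p)"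
    by (rule linear_frame_expansion[of p "\<lambda>v. b v (Y p)"]) (simp_all add: b1 XY)
  ultimately show ?thesis
    using contact_metric_ext_deriv[OF g' X Y, of p] by (simp add: be b_def[symmetric] algebra_simps)
qed

section \<open>Connection coefficients in the frame\<close>

lemma coframe_nab_metric:
  "hsign r k * coframe e k p (nab (e i) (e j) p) + hsign r j * coframe e j p (nab (e i) (e k) p) = 0"
proof -
  \<comment> \<open>Inner products of frame fields are constant, so metric compatibility becomes
    skew-symmetry of the coefficients.\<close>
  have "e i p (\<lambda>q. g q (e j q) (e k q)) = 0"
    by (simp add: metric_frame tangent_space_const[OF frame_tangent])
  then show ?thesis
    using nab_metric[of "e i" "e j" "e k" p]
    by (simp add: metric_frame_left metric_commute[OF frame_tangent] vector_fields_tangent)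
qed

lemma coframe_nab_torsion:
  "coframe e k p (nab (e i) (e j) p) - coframe e k p (nab (e j) (e i) p)
     = coframe e k p (lie_bracket (e i) (e j) p)"
proof -
  have "lie_bracket (e i) (e j) p =
      (\<lambda>f. 1 * nab (e i) (e j) p f + (-1) * nab (e j) (e i) p f + 0 * nab (e i) (e j) p f)"
    using nab_torsion_free[of "e i" "e j"] by (auto simp: fun_eq_iff)
  then show ?thesis
    by (simp only: coframe_lincomb3 vector_fields_tangent nab_vector_field frame_vector_field)
qed

definition nab_coeff :: real where "nab_coeff = (H + s) / 2"

lemma nab_frame_eqI:
  assumes "\<And>p j. coframe e j p (nab (e i) (e k) p) = (if j = l then c else 0)"
  shows "nab (e i) (e k) = vf_scale (\<lambda>_. c) (e l)"
  unfolding vf_scale_def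
  by (rule ext, subst frame_expansion[OF vector_fields_tangent]) (use exhaust_3[of l] assms in auto)

lemma nab_frame:
  "nab (e 1) (e 1) = vf_scale (\<lambda>_. 0) (e 1)"
  "nab (e 1) (e 2) = vf_scale (\<lambda>_. - nab_coeff) (e 3)"
  "nab (e 1) (e 3) = vf_scale (\<lambda>_. nab_coeff) (e 2)"
  "nab (e 2) (e 1) = vf_scale (\<lambda>_. s) (e 3)"
  "nab (e 2) (e 2) = vf_scale (\<lambda>_. 0) (e 1)"
  "nab (e 2) (e 3) = vf_scale (\<lambda>_. -1) (e 1)"
  "nab (e 3) (e 1) = vf_scale (\<lambda>_. - s) (e 2)"
  "nab (e 3) (e 2) = vf_scale (\<lambda>_. 1) (e 1)"
  "nab (e 3) (e 3) = vf_scale (\<lambda>_. 0) (e 1)"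
proof -
  \<comment> \<open>As in the Koszul formula, skew-symmetry \<open>m\<close> and the torsion
    equations \<open>t\<close> form a linear system that determines all 27 coefficients.\<close>
  define G where "G i j k p = coframe e k p (nab (e i) (e j) p)" for i j k p
  have m: "\<forall>j k. hsign r k * G i j k p + hsign r j * G i k j p = 0" for i p
    using coframe_nab_metric by (simp add: G_def)
  have t: "G 1 2 k p - G 2 1 k p = (if k = 3 then - bracket_coeff else 0)"
     "G 1 3 k p - G 3 1 k p = (if k = 2 then bracket_coeff else 0)"
     "G 2 3 k p - G 3 2 k p = (if k = 1 then - 2 else 0)" for k p
    using coframe_nab_torsion[of k p 1 2] coframe_nab_torsion[of k p 1 3] coframe_nab_torsion[of k p 2 3]
    by (simp_all add: G_def lie_bracket_frame coframe_vf_scale coframe_frame)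
  have nab_coeff: "nab_coeff = bracket_coeff - s"
    by (simp add: nab_coeff_def bracket_coeff_def field_simps)
  have "\<forall>j. G 1 1 j p = 0 \<and> G 1 2 j p = (if j = 3 then - nab_coeff else 0) \<and>
      G 1 3 j p = (if j = 2 then nab_coeff else 0) \<and>
      G 2 1 j p = (if j = 3 then s else 0) \<and> G 2 2 j p = 0 \<and> G 2 3 j p = (if j = 1 then -1 else 0) \<and>
      G 3 1 j p = (if j = 2 then - s else 0) \<and> G 3 2 j p = (if j = 1 then 1 else 0) \<and> G 3 3 j p = 0" for p
    using nab_coeff r m[of 1 p] m[of 2 p] m[of 3 p] t[of 1 p] t[of 2 p] t[of 3 p]
    unfolding forall_3 by (elim insertE) (auto simp: hsign_def)
  then show "nab (e 1) (e 1) = vf_scale (\<lambda>_. 0) (e 1)"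
    "nab (e 1) (e 2) = vf_scale (\<lambda>_. - nab_coeff) (e 3)"
    "nab (e 1) (e 3) = vf_scale (\<lambda>_. nab_coeff) (e 2)"
    "nab (e 2) (e 1) = vf_scale (\<lambda>_. s) (e 3)"
    "nab (e 2) (e 2) = vf_scale (\<lambda>_. 0) (e 1)"
    "nab (e 2) (e 3) = vf_scale (\<lambda>_. -1) (e 1)"
    "nab (e 3) (e 1) = vf_scale (\<lambda>_. - s) (e 2)"
    "nab (e 3) (e 2) = vf_scale (\<lambda>_. 1) (e 1)"
    "nab (e 3) (e 3) = vf_scale (\<lambda>_. 0) (e 1)"
    by (auto intro!: nab_frame_eqI simp: G_def)
qed

section \<open>The Ricci tensor in the frame\<close>

lemma coframe_curvature:
  assumes "X \<in> vector_fields C" "Y \<in> vector_fields C" "Z \<in> vector_fields C"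
  shows "coframe e j p (curvature nab X Y Z p) = coframe e j p (nab X (nab Y Z) p)
     - coframe e j p (nab Y (nab X Z) p) - coframe e j p (nab (lie_bracket X Y) Z p)"
  using coframe_lincomb3[of "nab X (nab Y Z) p" p "nab Y (nab X Z) p" "nab (lie_bracket X Y) Z p" j 1 "-1" "-1"]
    assms by (simp add: curvature_def vector_fields_tangent)

lemma curvature_vector_field [intro, simp]:
  assumes "X \<in> vector_fields C" "Y \<in> vector_fields C" "Z \<in> vector_fields C"
  shows "curvature nab X Y Z \<in> vector_fields C"
proof -
  have "curvature nab X Y Z = vf_add (nab X (nab Y Z))
      (vf_scale (\<lambda>p. -1) (vf_add (nab Y (nab X Z)) (nab (lie_bracket X Y) Z)))"
    by (simp add: curvature_def vf_add_def vf_scale_def algebra_simps)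
  then show ?thesis using assms by simp
qed

text \<open>All connection coefficients are constant, so the curvature is algebraic in them. Since
  g(\<xi>, \<xi>) = s, the values are those of (H + s) g + (1 - s H) \<eta> \<otimes>
  \<eta>.\<close>

lemma ricci_frame:
  "ricci nab e (e i) (e j) p = (if i = j then if i = 1 then 2 else H + s else 0)"
proof -
  have "s * s = 1" using r by auto
  then show ?thesis
    using exhaust_3[of i] exhaust_3[of j] unfolding ricci_def sum_3
    by (elim disjE) (simp_all add: coframe_curvature nab_frame lie_bracket_frame
        nab_scale_const_right nab_scale_left coframe_vf_scale coframe_frame
        nab_coeff_def bracket_coeff_def field_simps)
qed

lemma vf_frame_expansion:
  assumes "X \<in> vector_fields C"
  shows "X = vf_add (vf_add (vf_scale (\<lambda>p. coframe e 1 p (X p)) (e 1))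
    (vf_scale (\<lambda>p. coframe e 2 p (X p)) (e 2))) (vf_scale (\<lambda>p. coframe e 3 p (X p)) (e 3))"
  unfolding vf_add_def vf_scale_def by (rule ext, rule frame_expansion[OF vector_fields_tangent[OF assms]])

lemma ricci_expand_left:
  assumes X: "X \<in> vector_fields C" and Y: "Y \<in> vector_fields C"
  shows "ricci nab e X Y p = (\<Sum>k\<in>UNIV. coframe e k p (X p) * ricci nab e (e k) Y p)"
proof -
  have "coframe e j p (curvature nab (e j) X Y p)
      = (\<Sum>k\<in>UNIV. coframe e k p (X p) * coframe e j p (curvature nab (e j) (e k) Y p))" for j
    \<comment> \<open>Only the occurrence inside the curvature is expanded: the expansion mentions
      \<open>X\<close> again in its coefficients.\<close>
    by (subst (1) vf_frame_expansion[OF X]) (simp add: X Y coframe_vf_add coframe_vf_scale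
      curvature_add_middle curvature_scale_middle sum_3)
  then show ?thesis by (simp add: ricci_def sum_3 algebra_simps)
qed

lemma ricci_expand_right:
  assumes X: "X \<in> vector_fields C" and Y: "Y \<in> vector_fields C"
  shows "ricci nab e X Y p = (\<Sum>k\<in>UNIV. coframe e k p (Y p) * ricci nab e X (e k) p)"
proof -
  have "coframe e j p (curvature nab (e j) X Y p)
      = (\<Sum>k\<in>UNIV. coframe e k p (Y p) * coframe e j p (curvature nab (e j) X (e k) p))" for j
    by (subst (1) vf_frame_expansion[OF Y]) (simp add: X Y coframe_vf_add coframe_vf_scale
      curvature_add_right curvature_scale_right sum_3)
  then show ?thesis by (simp add: ricci_def sum_3 algebra_simps)
qed

lemma ricci_eq:
  assumes X: "X \<in> vector_fields C" and Y: "Y \<in> vector_fields C"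
  shows "ricci nab e X Y p = 2 * coframe e 1 p (X p) * coframe e 1 p (Y p)
    + (H + s) * (coframe e 2 p (X p) * coframe e 2 p (Y p) + coframe e 3 p (X p) * coframe e 3 p (Y p))"
  unfolding ricci_expand_left[OF X Y] ricci_expand_right[OF frame_vector_field Y]
  by (simp add: sum_3 ricci_frame algebra_simps)

section \<open>The electromagnetic field of the gauge potential\<close>

lemma ext_deriv_gauge:
  assumes X: "X \<in> vector_fields C" and Y: "Y \<in> vector_fields C"
  shows "ext_deriv (\<lambda>p v. B * \<eta> p v) X Y = (\<lambda>p. 2 * B *
    (coframe e 2 p (X p) * coframe e 3 p (Y p) - coframe e 3 p (X p) * coframe e 2 p (Y p)))"
proof
  fix p
  have "ext_deriv (\<lambda>p v. B * \<eta> p v) X Y p = B * ext_deriv \<eta> X Y p"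
    using X Y unfolding ext_deriv_def
    by (simp add: tangent_space_scale[OF vector_fields_tangent eta_smooth] algebra_simps)
  then show "ext_deriv (\<lambda>p v. B * \<eta> p v) X Y p = 2 * B *
    (coframe e 2 p (X p) * coframe e 3 p (Y p) - coframe e 3 p (X p) * coframe e 2 p (Y p))"
    by (simp add: ext_deriv_eta X Y)
qed

lemma star_d_star_gauge:
  "star_d_star r nab e (ext_deriv (\<lambda>p v. B * \<eta> p v)) p v = 4 * B * coframe e 1 p v"
proof -
  \<comment> \<open>The field has constant components, so only connection terms remain. The
    directions e_2 and e_3 each contribute -2Bs on e_1, and the prefactor -s turns their sum into
    4B.\<close>
  have "nabla_form2 nab (ext_deriv (\<lambda>p v. B * \<eta> p v)) (e j) (e j) (e k) p
      = (if j \<noteq> 1 \<and> k = 1 then - 2 * B * s else 0)" for j k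
    unfolding nabla_form2_def
    using exhaust_3[of j] exhaust_3[of k]
    by (elim disjE) (simp_all add: ext_deriv_gauge nab_frame coframe_vf_scale coframe_frame
        tangent_space_const[OF frame_tangent])
  then show ?thesis
    using r by (auto simp: star_d_star_def sum_3 hsign_def power_int_minus)
qed

text \<open>The contraction term is 4 B^2 on the span of e_2, e_3 and zero on e_1; the squared norm
  of the field is 8 B^2, which subtracts 2 B^2 times the metric.\<close>

lemma T_em_gauge:
  assumes X: "X \<in> vector_fields C" and Y: "Y \<in> vector_fields C"
  shows "T_em r g e (ext_deriv (\<lambda>p v. B * \<eta> p v)) X Y p
    = 2 * B\<^sup>2 * (- s * coframe e 1 p (X p) * coframe e 1 p (Y p)
      + coframe e 2 p (X p) * coframe e 2 p (Y p) + coframe e 3 p (X p) * coframe e 3 p (Y p))"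
  unfolding T_em_def
  by (simp add: sum_3 ext_deriv_gauge X Y coframe_frame hsign_def metric_eq vector_fields_tangent
      power2_eq_square algebra_simps)

end

section \<open>Spinors\<close>

lemma clifford_unit:
  "(- \<i>) powi (int 0 - 1) = \<i>" "(- \<i>) powi (int 1 - 1) = 1" "(- \<i>) powi (int (Suc 0) - 1) = 1"
  by (simp_all add: power_int_minus)

lemma gamma_mult:
  "gamma r 1 *v w = vector [(- \<i>) powi (int r - 1) * w $ 2, (- \<i>) powi (int r - 1) * w $ 1]"
  "gamma r 2 *v w = vector [w $ 2, - (w $ 1)]"
  "gamma r 3 *v w = vector [\<i> * w $ 1, - \<i> * w $ 2]"
  by (simp_all add: gamma_def pauli_def vec_eq_iff forall_2 matrix_matrix_mult_def
      matrix_vector_mult_def mat_def sum_2 flip: mult.assoc)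

lemma gamma_up_mult: "gamma_up r j *v w = of_real (hsign r j) *s (gamma r j *v w)"
  by (simp add: gamma_up_def vec_eq_iff forall_2 matrix_matrix_mult_def
      matrix_vector_mult_def mat_def sum_2 algebra_simps)

lemma spin_form_eq:
  "spin_form 0 v w = cnj (v $ 1) * w $ 1 + cnj (v $ 2) * w $ 2"
  "spin_form (Suc 0) v w = cnj (v $ 1) * w $ 2 + cnj (v $ 2) * w $ 1"
  by (simp_all add: spin_form_def sum_2 gamma_mult clifford_unit)

text \<open>Clifford multiplication at one point, taking the frame components of a vector, so that
  the spinorial identities concern a single element of \<open>complex^2\<close>.\<close>

definition clifford_at :: "nat \<Rightarrow> (3 \<Rightarrow> real) \<Rightarrow> complex^2 \<Rightarrow> complex^2" where
  "clifford_at r x w = (\<Sum>j\<in>UNIV. of_real (x j) *s (gamma r j *v w))"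

lemma clifford_eq: "clifford r e X \<psi> p = clifford_at r (\<lambda>j. coframe e j p (X p)) (\<psi> p)"
  by (simp add: clifford_def clifford_at_def)

lemma clifford_at_component:
  "clifford_at r x w $ 1 = of_real (x 1) * ((- \<i>) powi (int r - 1) * w $ 2) + of_real (x 2) * w $ 2
     + of_real (x 3) * (\<i> * w $ 1)"
  "clifford_at r x w $ 2 = of_real (x 1) * ((- \<i>) powi (int r - 1) * w $ 1) - of_real (x 2) * w $ 1
     - of_real (x 3) * (\<i> * w $ 2)"
  by (simp_all add: clifford_at_def sum_3 gamma_mult)

text \<open>The value that the SqK equation forces on the gauge-covariant derivative (charge 1,
  potential B \<eta>) in direction \<open>x\<close> at a point where the spinor equals
  \<open>w\<close>.\<close>

definition spin_derivative ::
  "nat \<Rightarrow> real \<Rightarrow> real \<Rightarrow> real \<Rightarrow> complex^2 \<Rightarrow> (3 \<Rightarrow> real) \<Rightarrow> complex^2" where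
  "spin_derivative r a b B w x = (of_real a * \<i> ^ r) *s clifford_at r x w
     + (of_real b * \<i> ^ r * of_real (x 1)) *s (gamma r 1 *v w) + (\<i> * of_real (B * x 1)) *s w"

lemma spin_form_self_real:
  assumes "r \<in> {0, 1}"
  shows "spin_form r w w = of_real (Re (spin_form r w w))"
  using assms by (auto simp: spin_form_eq complex_eq_iff)

section \<open>Algebra of eigenvectors of Clifford multiplication by the Reeb field\<close>

locale reeb_eigenspinor =
  fixes r :: nat and \<tau> :: real and w :: "complex^2"
  assumes r: "r \<in> {0, 1}" and sign: "\<tau> \<in> {1, -1}"
    and eigen: "gamma r 1 *v w = (of_real \<tau> * (- \<i>) powi (int r - 1)) *s w"
begin

lemma second_component: "w $ 2 = of_real \<tau> * w $ 1"
proof -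
  have "(gamma r 1 *v w) $ 1 = of_real \<tau> * (- \<i>) powi (int r - 1) * w $ 1"
    by (simp add: eigen)
  then show ?thesis
    using r unfolding gamma_mult by (elim insertE emptyE) (simp_all add: clifford_unit)
qed

text \<open>\<open>gamma r 2\<close> and \<open>gamma r 3\<close> anticommute with
  \<open>gamma r 1\<close>, hence swap its two eigenspaces, and these are orthogonal for
  \<open>spin_form\<close>; only the Reeb direction carries current.\<close>

lemma current_component:
  "spin_form r w (gamma_up r j *v w)
     = (if j = 1 then of_real ((-1) ^ r * \<tau>) * (- \<i>) powi (int r - 1) * spin_form r w w else 0)"
  using r sign second_component exhaust_3[of j]
  by (auto simp: spin_form_eq gamma_up_mult gamma_mult clifford_unit hsign_def)

text \<open>Each product of \<open>gamma_up r j\<close> with \<open>gamma r j\<close> is -1, which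
  gives 3a + b; the potential enters only through e_1, where the eigenvalue supplies \<tau>. The
  indicator has the shape produced by \<open>coframe_frame\<close>.\<close>

lemma dirac_eigenvalue:
  "(\<i> ^ r) *s (\<Sum>j\<in>UNIV. gamma_up r j *v spin_derivative r a b B w (\<lambda>k. if j = k then 1 else 0))
     = of_real (- ((-1) ^ r) * (3 * a + b + \<tau> * B)) *s w"
  using r sign second_component
  by (auto simp: sum_3 vec_eq_iff forall_2 gamma_up_mult gamma_mult clifford_unit hsign_def
      spin_derivative_def clifford_at_component algebra_simps)

text \<open>For the \<open>a\<close> term the Clifford relation x y + y x = -2 g(x, y) applies. In
  the \<open>b\<close> and \<open>B\<close> terms the cross terms vanish by the orthogonality of the
  eigenspaces, leaving the Reeb components.\<close>

lemma energy_momentum_spin: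
  "1 / 4 * Re (spin_form r w ((\<i> ^ r) *s (clifford_at r x (spin_derivative r a b B w y)
      + clifford_at r y (spin_derivative r a b B w x))))
   = - ((-1) ^ r) * a * Re (spin_form r w w) / 2 * ((-1) ^ r * x 1 * y 1 + x 2 * y 2 + x 3 * y 3)
     - (b + \<tau> * B) * Re (spin_form r w w) / 2 * x 1 * y 1"
  using r sign second_component
  by (elim insertE emptyE) (simp_all add: spin_derivative_def spin_form_eq gamma_mult clifford_unit
      clifford_at_component field_simps)

end

section \<open>The field equations\<close>

text \<open>\<open>T1\<close> and \<open>T2\<close> are the diagonal entries of the energy-momentum
  tensor on e_1 and on e_2, e_3. In the first equation \<open>T1\<close> cancels, leaving \<Lambda>
  = T2 + s. The second becomes H = s + T2 - s T1, linear in \<open>H\<close> because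
  \<open>T1\<close> reduces to -(H + s) N / 8.\<close>

lemma einstein_coefficients:
  fixes s \<tau> H B N \<Lambda> :: real
  assumes "s \<in> {1, -1}" "\<tau> \<in> {1, -1}" "4 * B = - s * \<tau> * N"
    and H: "N - s * 8 \<noteq> 0" "H = (- s * N\<^sup>2 + s * N - 8) / (N - s * 8)"
    and \<Lambda>: "\<Lambda> = N\<^sup>2 / 8 - N / 4 + s"
    and T1: "T1 = - 2 * s * B\<^sup>2 - s * (s / 2) * N / 2 * s - ((H - s) / 4 + \<tau> * B) * N / 2"
    and T2: "T2 = 2 * B\<^sup>2 - s * (s / 2) * N / 2"
  shows "2 = T1 - s * (s * T1 + 2 * T2) + 2 * s * \<Lambda>" "H + s = T2 - (s * T1 + 2 * T2) + 2 * \<Lambda>"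
proof -
  have H': "H * N = 8 * s * H - s * N\<^sup>2 + s * N - 8"
    using H by (simp add: field_simps)
  have B: "B = - s * \<tau> * N / 4" using assms(3) by simp
  have "s\<^sup>2 = 1" "\<tau>\<^sup>2 = 1" using assms(1,2) by auto
  then show "2 = T1 - s * (s * T1 + 2 * T2) + 2 * s * \<Lambda>" "H + s = T2 - (s * T1 + 2 * T2) + 2 * \<Lambda>"
    using assms(1,2) H' unfolding \<Lambda> T1 T2 B
    by (elim insertE emptyE; simp add: field_simps power2_eq_square)+
qed

theorem proposition4p8:
  fixes C :: "('m::{t2_space,second_countable_topology}) atlas"
    and r :: nat
    and \<phi> :: "'m endo" and \<xi> :: "'m vfield" and \<eta> :: "'m form1" and g :: "'m metric"
    and nab :: "'m connection" and e :: "3 \<Rightarrow> 'm vfield"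
    and \<psi> :: "'m spinor" and H B \<tau> :: real
  assumes r: "r \<in> {0, 1}"
    and space_form: "pseudo_sasakian_space_form3 C r \<phi> \<xi> \<eta> g nab H"
    and frame: "sasakian_frame C r H \<xi> g e"
    and sqk: "sqk_spinor C r H \<xi> \<eta> e ((-1) ^ r / 2) ((H - (-1) ^ r) / 4) \<psi>"
    and sign: "\<tau> \<in> {1, -1}"
    and eigen: "\<forall>p. clifford r e \<xi> \<psi> p = (of_real \<tau> * (- \<i>) powi (int r - 1)) *s \<psi> p"
    and B: "\<forall>p. complex_of_real (4 * B) =
              of_real \<tau> * (-1) powi (int r - 1) * spin_form r (\<psi> p) (\<psi> p)"
  shows "DM_system C r H g nab e 1 (\<lambda>p v. B * \<eta> p v) \<psi> \<and>
    (\<forall>\<Lambda>::real.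
      (\<forall>p. spin_form r (\<psi> p) (\<psi> p) - (-1) ^ r * 8 \<noteq> 0) \<and>
      (\<forall>p. complex_of_real H =
         (- ((-1) ^ r) * (spin_form r (\<psi> p) (\<psi> p))\<^sup>2
            + (-1) ^ r * spin_form r (\<psi> p) (\<psi> p) - 8)
         / (spin_form r (\<psi> p) (\<psi> p) - (-1) ^ r * 8)) \<and>
      (\<forall>p. complex_of_real \<Lambda> =
         (spin_form r (\<psi> p) (\<psi> p))\<^sup>2 / 8 - spin_form r (\<psi> p) (\<psi> p) / 4 + (-1) ^ r) \<longrightarrow>
      EDM_system C r H g nab e 1 (\<lambda>p v. B * \<eta> p v) \<psi> \<Lambda>)"
proof -
  interpret sasakian_frame_geometry C g nab r H \<phi> \<xi> \<eta> e
    using r frame space_form unfolding pseudo_sasakian_space_form3_def by unfold_locales auto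
  define a b where "a = s / 2" and "b = (H - s) / 4"
  define A where "A = (\<lambda>p v. B * \<eta> p v)"
  define N where "N p = Re (spin_form r (\<psi> p) (\<psi> p))" for p
  have N: "spin_form r (\<psi> p) (\<psi> p) = of_real (N p)" for p
    unfolding N_def using r by (rule spin_form_self_real)
  have s: "s \<in> {1, -1}" using r by auto
  have reeb: "clifford r e \<xi> \<psi> p = gamma r 1 *v \<psi> p" for p
    by (simp add: clifford_def sum_3 coframe_frame flip: e1)
  interpret spinor: reeb_eigenspinor r \<tau> "\<psi> p" for p
    using r sign eigen by unfold_locales (auto simp: reeb)
  have BN: "4 * B = - s * \<tau> * N p" for p
  proof -
    have "complex_of_real (4 * B) = of_real (- s * \<tau> * N p)"
      using B r by (auto simp: N power_int_minus)
    then show ?thesis by (simp only: of_real_eq_iff)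
  qed
  \<comment> \<open>From here on no derivative of the spinor occurs: the SqK equation supplies the
    covariant derivative and the potential adds a multiple of the spinor.\<close>
  have nabla: "gauge_nabla r H e 1 A X \<psi> p = spin_derivative r a b B (\<psi> p) (\<lambda>j. coframe e j p (X p))"
    if "X \<in> vector_fields C" for X p
    using sqk that
    by (simp add: sqk_spinor_def gauge_nabla_def spin_derivative_def a_def b_def A_def reeb
        clifford_eq[of _ _ X] eta_eq_coframe vector_fields_tangent)
  have dirac: "dirac_equation r H e 1 A \<psi>"
    unfolding dirac_equation_def gauge_dirac_def nabla[OF frame_vector_field] coframe_frame
    using spinor.dirac_eigenvalue by blast
  have maxwell: "maxwell_equation C r g nab e 1 A \<psi>"
    unfolding maxwell_equation_def
  proof (intro allI ballI)
    fix p v assume v: "v \<in> tangent_space C p"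
    \<comment> \<open>One factor of the square is the normalisation of the current, the other the
      Reeb eigenvalue; the sign from raising the index cancels the one from lowering it.\<close>
    have "current_flat r g e \<psi> p v
        = ((- \<i>) powi (int r - 1))\<^sup>2 * of_real (\<tau> * N p * coframe e 1 p v)"
      using s v by (auto simp: current_flat_def sum_3 spinor.current_component N power2_eq_square
          metric_frame_left metric_commute[OF frame_tangent] hsign_def)
    also have "((- \<i>) powi (int r - 1))\<^sup>2 = of_real (- s)"
      using r by (auto simp: clifford_unit)
    finally show "of_real (star_d_star r nab e (ext_deriv A) p v) = of_real 1 * current_flat r g e \<psi> p v"
      unfolding A_def star_d_star_gauge BN[of p] by simp
  qed
  have T_spin: "T_spin r H e 1 A \<psi> X Y p = - s * a * N p / 2 * g p (X p) (Y p)
      - (b + \<tau> * B) * N p / 2 * coframe e 1 p (X p) * coframe e 1 p (Y p)"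
    if "X \<in> vector_fields C" "Y \<in> vector_fields C" for X Y p
    unfolding T_spin_def clifford_eq nabla[OF that(1)] nabla[OF that(2)] spinor.energy_momentum_spin
    by (simp add: N_def metric_eq vector_fields_tangent that)
  have einstein: "einstein_equation C r H g nab e 1 A \<psi> \<Lambda>"
    if nz: "\<forall>p. spin_form r (\<psi> p) (\<psi> p) - (-1) ^ r * 8 \<noteq> 0"
      and H: "\<forall>p. complex_of_real H =
         (- ((-1) ^ r) * (spin_form r (\<psi> p) (\<psi> p))\<^sup>2
            + (-1) ^ r * spin_form r (\<psi> p) (\<psi> p) - 8)
         / (spin_form r (\<psi> p) (\<psi> p) - (-1) ^ r * 8)"
      and \<Lambda>: "\<forall>p. complex_of_real \<Lambda> =
         (spin_form r (\<psi> p) (\<psi> p))\<^sup>2 / 8 - spin_form r (\<psi> p) (\<psi> p) / 4 + (-1) ^ r"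
    for \<Lambda> :: real
    unfolding einstein_equation_def Let_def
  proof (intro ballI allI)
    fix X Y p assume X: "X \<in> vector_fields C" and Y: "Y \<in> vector_fields C"
    define T1 where "T1 = - 2 * s * B\<^sup>2 - s * (s / 2) * N p / 2 * s - ((H - s) / 4 + \<tau> * B) * N p / 2"
    define T2 where "T2 = 2 * B\<^sup>2 - s * (s / 2) * N p / 2"
    \<comment> \<open>The hypotheses are equations between complex numbers; as the spin form is real
      on the diagonal, they descend to real ones.\<close>
    have "complex_of_real (N p - s * 8) \<noteq> 0" using nz by (simp add: N)
    then have nz': "N p - s * 8 \<noteq> 0" unfolding of_real_eq_0_iff .
    have "complex_of_real H = of_real ((- s * (N p)\<^sup>2 + s * N p - 8) / (N p - s * 8))"
      using H by (simp add: N)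
    then have H': "H = (- s * (N p)\<^sup>2 + s * N p - 8) / (N p - s * 8)" by (simp only: of_real_eq_iff)
    have "complex_of_real \<Lambda> = of_real ((N p)\<^sup>2 / 8 - N p / 4 + s)"
      using \<Lambda> by (simp add: N)
    then have \<Lambda>': "\<Lambda> = (N p)\<^sup>2 / 8 - N p / 4 + s" by (simp only: of_real_eq_iff)
    note coeffs = einstein_coefficients[OF s sign BN nz' H' \<Lambda>' T1_def T2_def]
    let ?T = "\<lambda>X Y p. T_em r g e (ext_deriv A) X Y p + T_spin r H e 1 A \<psi> X Y p"
    let ?x = "\<lambda>j. coframe e j p (X p)" and ?y = "\<lambda>j. coframe e j p (Y p)"
    have T: "?T X Y p = T1 * coframe e 1 p (X p) * coframe e 1 p (Y p)
       + T2 * (coframe e 2 p (X p) * coframe e 2 p (Y p) + coframe e 3 p (X p) * coframe e 3 p (Y p))"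
      if "X \<in> vector_fields C" "Y \<in> vector_fields C" for X Y
      \<comment> \<open>The spinor part is rewritten while \<open>A\<close> is still folded; the
        electromagnetic part needs the explicit potential.\<close>
      unfolding T_spin[OF that]
      unfolding A_def T_em_gauge[OF that] T1_def T2_def a_def b_def
        metric_eq[OF that[THEN vector_fields_tangent]] by (simp add: field_simps)
    have tr: "trace_form r e ?T p = s * T1 + 2 * T2"
      by (simp add: trace_form_def sum_3 T coframe_frame hsign_def)
    \<comment> \<open>Both sides of the Einstein equation are diagonal with equal entries on e_2 and
      e_3, so the two scalar identities in \<open>coeffs\<close> suffice.\<close>
    have "2 * (?x 1 * ?y 1) + (H + s) * (?x 2 * ?y 2 + ?x 3 * ?y 3)
      = (T1 - s * (s * T1 + 2 * T2) + 2 * s * \<Lambda>) * (?x 1 * ?y 1)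
       + (T2 - (s * T1 + 2 * T2) + 2 * \<Lambda>) * (?x 2 * ?y 2 + ?x 3 * ?y 3)"
      unfolding coeffs[symmetric] ..
    then show "ricci nab e X Y p
        = ?T X Y p - trace_form r e ?T p * g p (X p) (Y p) + 2 * \<Lambda> * g p (X p) (Y p)"
      unfolding tr T[OF X Y] ricci_eq[OF X Y] metric_eq[OF X[THEN vector_fields_tangent] Y[THEN vector_fields_tangent]]
      by (simp add: algebra_simps)
  qed
  show ?thesis
    using dirac maxwell einstein unfolding EDM_system_def DM_system_def A_def by blast
qed

end
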